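(* Let $X$ be a quasimetric space and let $\ell>r\ge0$ be real numbers. Then there is an isomorphism of $\mathbb K$-modules $$\mathrm{SH}^r_{1,\{\ell\}}(X)\cong\mathbb K\cdot\big((\mathrm{Adj}_\ell\cap\mathrm{Adj}_{\ell,r})/\sim\big),$$ where $\sim$ is the equivalence relation induced from the equivalence relation on $\mathrm{Adj}_{\ell,r}$, and $\mathbb K\cdot S$ denotes the free $\mathbb K$-module on a set $S$.
   Context: A quasimetric space is a set $X$ with $d:X\times X\to[0,+\infty]$ satisfying the triangle inequality and $d(x,y)=0\iff x=y$ (not necessarily symmetric). $\mathbb K$ is a commutative ring. Adjacency. A pair $(x,y)\in X^2$ is $\ell$-adjacent if $d(x,y)=\ell$ and there is no point $a\ne x,y$ with $d(x,a)+d(a,y)=\ell$; $\mathrm{Adj}_\ell$ is the set of $\ell$-adjacent pairs. For $\ell>r\ge0$ let $P_{\le\ell+r}=\{(x,y)\in X^2\mid d(x,y)\le\ell+r\}$. Let $\sim$ be the smallest equivalence relation on $P_{\le\ell+r}$ such that: $(x,y)\sim(x',y)$ if $d(x,x')\le r$ and $d(x,x')+d(x',y)\le\ell+r$; and $(x,y)\sim(x,y')$ if $d(y',y)\le r$ and $d(x,y')+d(y',y)\le\ell+r$. A pair $(x,y)\in P_{\le\ell+r}$ is $(\ell,r)$-trivial if there is a point $a\in X$ (possibly equal to $x$ or $y$) with $d(x,a)+d(a,y)\le\ell+r$, $d(x,a)<\ell$ and $d(a,y)<\ell$; the set of these is $T_{\ell,r}$. Let $\overline T_{\ell,r}$ be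 the set of pairs in $P_{\le\ell+r}$ that are $\sim$-equivalent to an $(\ell,r)$-trivial pair, and $\mathrm{Adj}_{\ell,r}=P_{\le\ell+r}\setminus\overline T_{\ell,r}$, with the restricted equivalence relation $\sim$. Spectral homology. $\mathrm{RC}(X)$ is the chain complex with $\mathrm{RC}_n(X)$ the free $\mathbb K$-module on tuples $(x_0,\dots,x_n)$ with $x_i\ne x_{i+1}$ and $d(x_i,x_{i+1})<+\infty$, differential $\partial(x_0,\dots,x_n)=\sum_{i=0}^n(-1)^i(x_0,\dots,\hat x_i,\dots,x_n)$, where tuples with a consecutive repetition are set equal to $0$. $F_s\mathrm{RC}(X)$, $s\in\mathbb R$, is spanned by tuples with $\sum_i d(x_i,x_{i+1})\le s$. For a downward closed $L\subseteq\mathbb R$ put $F_L=\bigcup_{s\in L}F_s\mathrm{RC}(X)$ (zero if $L=\emptyset$). Every non-empty interval (convex subset) $I\subseteq\mathbb R$ is uniquely $I=R_I\setminus L_I$ with $R_I=\{s\mid\exists i\in I,\ s\le i\}$, $L_I=\{s\mid\forall i\in I,\ s<i\}$; put $C_I=F_{R_I}/F_{L_I}$, $I_{-r}=R_I\setminus(L_I-r)$, $I^{+r}=(R_I+r)\setminus L_I$. With maps induced by inclusions, $\mathrm{SZ}^r_{n,I}(X)=\mathrm{Im}(H_n(C_{I_{-r}})\to H_n(C_I))$, $\mathrm{SB}^r_{n,I}(X)=\mathrm{Ker}(H_n(C_I)\to H_n(C_{I^{+r}}))\subseteq \mathrm{SZ}^r_{n,I}(X)$, and $\mathrm{SH}^r_{n,I}(X)=\mathrm{SZ}^r_{n,I}(X)/\mathrm{SB}^r_{n,I}(X)\cong\mathrm{Im}(H_n(C_{I_{-r}})\to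 H_n(C_{I^{+r}}))$. *)

theory Defs
  imports "HOL-Library.Extended_Real" "HOL-Algebra.Module" "HOL-Algebra.AbelCoset"
begin

section \<open>Modules over a commutative ring\<close>

text \<open>The multiplicative part of the underlying ring record plays no role for modules.\<close>

definition free_module :: "('k, 'm) ring_scheme \<Rightarrow> 'b set \<Rightarrow> ('k, 'b \<Rightarrow> 'k) module" where
  "free_module K S =
    \<lparr>carrier = {f. (\<forall>x. f x \<in> carrier K) \<and> {x. f x \<noteq> \<zero>\<^bsub>K\<^esub>} \<subseteq> S \<and> finite {x. f x \<noteq> \<zero>\<^bsub>K\<^esub>}},
     mult = undefined, one = undefined,
     zero = (\<lambda>_. \<zero>\<^bsub>K\<^esub>), add = (\<lambda>f g x. f x \<oplus>\<^bsub>K\<^esub> g x),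
     smult = (\<lambda>a f x. a \<otimes>\<^bsub>K\<^esub> f x)\<rparr>"

text \<open>The map on cosets induced by \<open>f\<close>, with values in the cosets of \<open>N\<close> in \<open>M\<close>; when \<open>f\<close> is a
  homomorphism respecting the two submodules, all terms of the union are the same coset.\<close>

definition quot_map :: "('k, 'c, 'e) module_scheme \<Rightarrow> 'c set \<Rightarrow> ('b \<Rightarrow> 'c) \<Rightarrow> 'b set \<Rightarrow> 'c set" where
  "quot_map M N f A = (\<Union>x\<in>A. N +>\<^bsub>M\<^esub> f x)"

definition quot_module :: "('k, 'b, 'e) module_scheme \<Rightarrow> 'b set \<Rightarrow> ('k, 'b set) module" where
  "quot_module M N =
    \<lparr>carrier = a_rcosets\<^bsub>M\<^esub> N, mult = undefined, one = undefined,
     zero = N, add = (<+>\<^bsub>M\<^esub>),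
     smult = (\<lambda>a. quot_map M N (\<lambda>x. a \<odot>\<^bsub>M\<^esub> x))\<rparr>"

definition module_isos ::
  "('k, 'm) ring_scheme \<Rightarrow> ('k, 'b, 'e) module_scheme \<Rightarrow> ('k, 'c, 'f) module_scheme \<Rightarrow> ('b \<Rightarrow> 'c) set"
where
  "module_isos K M N =
    {h. bij_betw h (carrier M) (carrier N)
      \<and> (\<forall>x\<in>carrier M. \<forall>y\<in>carrier M. h (x \<oplus>\<^bsub>M\<^esub> y) = h x \<oplus>\<^bsub>N\<^esub> h y)
      \<and> (\<forall>a\<in>carrier K. \<forall>x\<in>carrier M. h (a \<odot>\<^bsub>M\<^esub> x) = a \<odot>\<^bsub>N\<^esub> h x)}"

definition isomorphic_modules ::
  "('k, 'm) ring_scheme \<Rightarrow> ('k, 'b, 'e) module_scheme \<Rightarrow> ('k, 'c, 'f) module_scheme \<Rightarrow> bool"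
where
  "isomorphic_modules K M N \<longleftrightarrow> module K M \<and> module K N \<and> module_isos K M N \<noteq> {}"

text \<open>Homology of a complex \<open>C 0 \<leftarrow> C 1 \<leftarrow> \<dots>\<close> with differentials \<open>D n : C n \<rightarrow> C (n - 1)\<close>. Because of
  truncated subtraction \<open>D 0\<close> is a map from \<open>C 0\<close> to itself; it is meant to be zero.\<close>

definition cycles ::
  "(nat \<Rightarrow> ('k, 'b, 'e) module_scheme) \<Rightarrow> (nat \<Rightarrow> 'b \<Rightarrow> 'b) \<Rightarrow> nat \<Rightarrow> 'b set" where
  "cycles C D n = a_kernel (C n) (C (n - 1)) (D n)"

definition boundaries ::
  "(nat \<Rightarrow> ('k, 'b, 'e) module_scheme) \<Rightarrow> (nat \<Rightarrow> 'b \<Rightarrow> 'b) \<Rightarrow> nat \<Rightarrow> 'b set" where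
  "boundaries C D n = D (Suc n) ` carrier (C (Suc n))"

definition homology ::
  "(nat \<Rightarrow> ('k, 'b) module) \<Rightarrow> (nat \<Rightarrow> 'b \<Rightarrow> 'b) \<Rightarrow> nat \<Rightarrow> ('k, 'b set) module" where
  "homology C D n = quot_module (C n\<lparr>carrier := cycles C D n\<rparr>) (boundaries C D n)"


section \<open>Quasimetric spaces and adjacency\<close>

locale quasimetric_space =
  fixes X :: "'a set" and d :: "'a \<Rightarrow> 'a \<Rightarrow> ereal"
  assumes nonneg: "\<lbrakk>x \<in> X; y \<in> X\<rbrakk> \<Longrightarrow> 0 \<le> d x y"
    and zero_iff: "\<lbrakk>x \<in> X; y \<in> X\<rbrakk> \<Longrightarrow> d x y = 0 \<longleftrightarrow> x = y"
    and triangle: "\<lbrakk>x \<in> X; y \<in> X; z \<in> X\<rbrakk> \<Longrightarrow> d x z \<le> d x y + d y z"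

definition Adj :: "'a set \<Rightarrow> ('a \<Rightarrow> 'a \<Rightarrow> ereal) \<Rightarrow> real \<Rightarrow> ('a \<times> 'a) set" where
  "Adj X d l = {(x, y). x \<in> X \<and> y \<in> X \<and> d x y = ereal l
    \<and> \<not> (\<exists>a\<in>X. a \<noteq> x \<and> a \<noteq> y \<and> d x a + d a y = ereal l)}"

definition close_pairs :: "'a set \<Rightarrow> ('a \<Rightarrow> 'a \<Rightarrow> ereal) \<Rightarrow> real \<Rightarrow> ('a \<times> 'a) set" where
  "close_pairs X d t = {(x, y). x \<in> X \<and> y \<in> X \<and> d x y \<le> ereal t}"

definition pair_moves ::
  "'a set \<Rightarrow> ('a \<Rightarrow> 'a \<Rightarrow> ereal) \<Rightarrow> real \<Rightarrow> real \<Rightarrow> (('a \<times> 'a) \<times> ('a \<times> 'a)) set" where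
  "pair_moves X d l r =
    {((x, y), (x', y)) |x x' y. (x, y) \<in> close_pairs X d (l + r) \<and> (x', y) \<in> close_pairs X d (l + r)
      \<and> d x x' \<le> ereal r \<and> d x x' + d x' y \<le> ereal (l + r)}
    \<union> {((x, y), (x, y')) |x y y'. (x, y) \<in> close_pairs X d (l + r) \<and> (x, y') \<in> close_pairs X d (l + r)
      \<and> d y' y \<le> ereal r \<and> d x y' + d y' y \<le> ereal (l + r)}"

definition pair_equiv ::
  "'a set \<Rightarrow> ('a \<Rightarrow> 'a \<Rightarrow> ereal) \<Rightarrow> real \<Rightarrow> real \<Rightarrow> (('a \<times> 'a) \<times> ('a \<times> 'a)) set" where
  "pair_equiv X d l r = \<Inter>{E. equiv (close_pairs X d (l + r)) E \<and> pair_moves X d l r \<subseteq> E}"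

definition trivial_pairs :: "'a set \<Rightarrow> ('a \<Rightarrow> 'a \<Rightarrow> ereal) \<Rightarrow> real \<Rightarrow> real \<Rightarrow> ('a \<times> 'a) set" where
  "trivial_pairs X d l r = {(x, y). (x, y) \<in> close_pairs X d (l + r)
    \<and> (\<exists>a\<in>X. d x a + d a y \<le> ereal (l + r) \<and> d x a < ereal l \<and> d a y < ereal l)}"

definition Adj_thick :: "'a set \<Rightarrow> ('a \<Rightarrow> 'a \<Rightarrow> ereal) \<Rightarrow> real \<Rightarrow> real \<Rightarrow> ('a \<times> 'a) set" where
  "Adj_thick X d l r = close_pairs X d (l + r) - pair_equiv X d l r `` trivial_pairs X d l r"


section \<open>Spectral homology\<close>

definition path_length :: "('a \<Rightarrow> 'a \<Rightarrow> ereal) \<Rightarrow> 'a list \<Rightarrow> ereal" where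
  "path_length d xs = (\<Sum>(x, y)\<leftarrow>zip xs (tl xs). d x y)"

definition tuples :: "'a set \<Rightarrow> ('a \<Rightarrow> 'a \<Rightarrow> ereal) \<Rightarrow> nat \<Rightarrow> 'a list set" where
  "tuples X d n = {xs. length xs = Suc n \<and> set xs \<subseteq> X \<and> distinct_adj xs
    \<and> successively (\<lambda>x y. d x y < \<infinity>) xs}"

definition RC :: "('k, 'm) ring_scheme \<Rightarrow> 'a set \<Rightarrow> ('a \<Rightarrow> 'a \<Rightarrow> ereal) \<Rightarrow> nat
    \<Rightarrow> ('k, 'a list \<Rightarrow> 'k) module" where
  "RC K X d n = free_module K (tuples X d n)"

definition tuple_elt :: "('k, 'm) ring_scheme \<Rightarrow> 'a list \<Rightarrow> 'a list \<Rightarrow> 'k" where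
  "tuple_elt K xs = (\<lambda>ys. if distinct_adj xs \<and> ys = xs then \<one>\<^bsub>K\<^esub> else \<zero>\<^bsub>K\<^esub>)"

definition RC_diff_tuple :: "('k, 'm) ring_scheme \<Rightarrow> 'a set \<Rightarrow> ('a \<Rightarrow> 'a \<Rightarrow> ereal) \<Rightarrow> nat
    \<Rightarrow> 'a list \<Rightarrow> ('a list \<Rightarrow> 'k)" where
  "RC_diff_tuple K X d n xs = (\<Oplus>\<^bsub>RC K X d (n - 1)\<^esub> i\<in>{..n}.
      ((\<ominus>\<^bsub>K\<^esub> \<one>\<^bsub>K\<^esub>) [^]\<^bsub>K\<^esub> i) \<odot>\<^bsub>RC K X d (n - 1)\<^esub> tuple_elt K (take i xs @ drop (Suc i) xs))"

definition RC_diff :: "('k, 'm) ring_scheme \<Rightarrow> 'a set \<Rightarrow> ('a \<Rightarrow> 'a \<Rightarrow> ereal) \<Rightarrow> nat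
    \<Rightarrow> ('a list \<Rightarrow> 'k) \<Rightarrow> ('a list \<Rightarrow> 'k)" where
  "RC_diff K X d n c =
    (if n = 0 then \<zero>\<^bsub>RC K X d 0\<^esub>
     else (\<Oplus>\<^bsub>RC K X d (n - 1)\<^esub> xs\<in>{xs. c xs \<noteq> \<zero>\<^bsub>K\<^esub>}.
            c xs \<odot>\<^bsub>RC K X d (n - 1)\<^esub> RC_diff_tuple K X d n xs))"

definition RC_filt :: "('k, 'm) ring_scheme \<Rightarrow> 'a set \<Rightarrow> ('a \<Rightarrow> 'a \<Rightarrow> ereal) \<Rightarrow> real \<Rightarrow> nat
    \<Rightarrow> ('a list \<Rightarrow> 'k) set" where
  "RC_filt K X d s n =
    {c \<in> carrier (RC K X d n). \<forall>xs. c xs \<noteq> \<zero>\<^bsub>K\<^esub> \<longrightarrow> path_length d xs \<le> ereal s}"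

text \<open>Inserting zero only matters for \<open>L = {}\<close>.\<close>

definition RC_filt_set :: "('k, 'm) ring_scheme \<Rightarrow> 'a set \<Rightarrow> ('a \<Rightarrow> 'a \<Rightarrow> ereal) \<Rightarrow> real set \<Rightarrow> nat
    \<Rightarrow> ('a list \<Rightarrow> 'k) set" where
  "RC_filt_set K X d L n = insert \<zero>\<^bsub>RC K X d n\<^esub> (\<Union>s\<in>L. RC_filt K X d s n)"

text \<open>An interval \<open>I\<close> is the difference of the downward closed sets \<open>int_R I\<close> and \<open>int_L I\<close>.\<close>

definition int_R :: "real set \<Rightarrow> real set" where
  "int_R I = {s. \<exists>i\<in>I. s \<le> i}"

definition int_L :: "real set \<Rightarrow> real set" where
  "int_L I = {s. \<forall>i\<in>I. s < i}"

definition int_minus :: "real set \<Rightarrow> real \<Rightarrow> real set" where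
  "int_minus I r = int_R I - (\<lambda>s. s - r) ` int_L I"

definition int_plus :: "real set \<Rightarrow> real \<Rightarrow> real set" where
  "int_plus I r = (\<lambda>s. s + r) ` int_R I - int_L I"

definition RC_upper :: "('k, 'm) ring_scheme \<Rightarrow> 'a set \<Rightarrow> ('a \<Rightarrow> 'a \<Rightarrow> ereal) \<Rightarrow> real set \<Rightarrow> nat
    \<Rightarrow> ('k, 'a list \<Rightarrow> 'k) module" where
  "RC_upper K X d I n = RC K X d n\<lparr>carrier := RC_filt_set K X d (int_R I) n\<rparr>"

definition RC_int :: "('k, 'm) ring_scheme \<Rightarrow> 'a set \<Rightarrow> ('a \<Rightarrow> 'a \<Rightarrow> ereal) \<Rightarrow> real set \<Rightarrow> nat
    \<Rightarrow> ('k, ('a list \<Rightarrow> 'k) set) module" where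
  "RC_int K X d I n = quot_module (RC_upper K X d I n) (RC_filt_set K X d (int_L I) n)"

definition RC_int_diff :: "('k, 'm) ring_scheme \<Rightarrow> 'a set \<Rightarrow> ('a \<Rightarrow> 'a \<Rightarrow> ereal) \<Rightarrow> real set \<Rightarrow> nat
    \<Rightarrow> ('a list \<Rightarrow> 'k) set \<Rightarrow> ('a list \<Rightarrow> 'k) set" where
  "RC_int_diff K X d I n =
    quot_map (RC_upper K X d I (n - 1)) (RC_filt_set K X d (int_L I) (n - 1)) (RC_diff K X d n)"

definition H_int :: "('k, 'm) ring_scheme \<Rightarrow> 'a set \<Rightarrow> ('a \<Rightarrow> 'a \<Rightarrow> ereal) \<Rightarrow> real set \<Rightarrow> nat
    \<Rightarrow> ('k, ('a list \<Rightarrow> 'k) set set) module" where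
  "H_int K X d I n = homology (RC_int K X d I) (RC_int_diff K X d I) n"

text \<open>For intervals with \<open>int_R I \<subseteq> int_R J\<close> and \<open>int_L I \<subseteq> int_L J\<close>: the maps \<open>C_I \<rightarrow> C_J\<close> and
  \<open>H_n(C_I) \<rightarrow> H_n(C_J)\<close> induced by the inclusions.\<close>

definition RC_int_map :: "('k, 'm) ring_scheme \<Rightarrow> 'a set \<Rightarrow> ('a \<Rightarrow> 'a \<Rightarrow> ereal) \<Rightarrow> real set \<Rightarrow> nat
    \<Rightarrow> ('a list \<Rightarrow> 'k) set \<Rightarrow> ('a list \<Rightarrow> 'k) set" where
  "RC_int_map K X d J n =
    quot_map (RC_upper K X d J n) (RC_filt_set K X d (int_L J) n) (\<lambda>c. c)"

definition H_int_map :: "('k, 'm) ring_scheme \<Rightarrow> 'a set \<Rightarrow> ('a \<Rightarrow> 'a \<Rightarrow> ereal) \<Rightarrow> real set \<Rightarrow> nat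
    \<Rightarrow> ('a list \<Rightarrow> 'k) set set \<Rightarrow> ('a list \<Rightarrow> 'k) set set" where
  "H_int_map K X d J n =
    quot_map (RC_int K X d J n\<lparr>carrier := cycles (RC_int K X d J) (RC_int_diff K X d J) n\<rparr>)
      (boundaries (RC_int K X d J) (RC_int_diff K X d J) n) (RC_int_map K X d J n)"

definition SZ :: "('k, 'm) ring_scheme \<Rightarrow> 'a set \<Rightarrow> ('a \<Rightarrow> 'a \<Rightarrow> ereal) \<Rightarrow> real \<Rightarrow> nat \<Rightarrow> real set
    \<Rightarrow> ('a list \<Rightarrow> 'k) set set set" where
  "SZ K X d r n I = H_int_map K X d I n ` carrier (H_int K X d (int_minus I r) n)"

definition SB :: "('k, 'm) ring_scheme \<Rightarrow> 'a set \<Rightarrow> ('a \<Rightarrow> 'a \<Rightarrow> ereal) \<Rightarrow> real \<Rightarrow> nat \<Rightarrow> real set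
    \<Rightarrow> ('a list \<Rightarrow> 'k) set set set" where
  "SB K X d r n I =
    a_kernel (H_int K X d I n) (H_int K X d (int_plus I r) n) (H_int_map K X d (int_plus I r) n)"

definition SH :: "('k, 'm) ring_scheme \<Rightarrow> 'a set \<Rightarrow> ('a \<Rightarrow> 'a \<Rightarrow> ereal) \<Rightarrow> real \<Rightarrow> nat \<Rightarrow> real set
    \<Rightarrow> ('k, ('a list \<Rightarrow> 'k) set set set) module" where
  "SH K X d r n I = quot_module (H_int K X d I n\<lparr>carrier := SZ K X d r n I\<rparr>) (SB K X d r n I)"

end

theory Submission
  imports Defs
begin

text \<open>
  Tuples of length zero already lie in the lower filtration step of each of the three intervals
  \<open>[l - r, l]\<close>, \<open>{l}\<close> and \<open>[l, l + r]\<close>, because \<open>l - r > 0\<close>. So the quotient complexes vanish in degree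
  0, every 1-chain is a cycle, and the group of surviving cycles is all of the first homology of the
  interval \<open>{l}\<close>. Consequently the spectral homology is the quotient of the free module on pairs at
  distance at most \<open>l\<close> by the chains that become boundaries, up to chains of length below \<open>l\<close>, inside
  length \<open>l + r\<close>.

  The boundary of a triple \<open>(x, a, y)\<close> of length at most \<open>l + r\<close> is the relation
  \<open>[x, y] = [x, a] + [a, y]\<close>, and a pair of distance less than \<open>l\<close> counts as zero. As \<open>2 l > l + r\<close>, at
  most one of the two summands has distance at least \<open>l\<close>. If none has, then \<open>(x, y)\<close> is trivial and the
  relation reads \<open>[x, y] = 0\<close>. If one has, then the other has distance at most \<open>r\<close>, and the relation
  identifies \<open>(x, y)\<close> with a pair to which it is related by an elementary move. These are precisely
  the moves that generate the equivalence of pairs, so what remains is free on the classes free of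
  trivial pairs. The chains considered have distance at most \<open>l\<close>, and in such a class only distance
  exactly \<open>l\<close> can occur, which is why only the classes that meet \<open>Adj X d l\<close> remain: a pair at distance
  \<open>l\<close> that fails to be \<open>l\<close>-adjacent is itself trivial.

  Formally, two surjections out of the module of 1-chains of length at most \<open>l\<close> are compared: the
  projection to the spectral homology and the map \<open>class_map\<close> to the free module on classes. They have
  the same kernel (\<open>class_map_zero_iff\<close>), and hence isomorphic targets
  (\<open>isomorphic_modules_of_same_kernel\<close>). The map \<open>class_map\<close> kills boundaries by the case distinction above
  (\<open>cls_vec_triangle\<close>). Conversely, choosing a representative of each class gives a section, and
  applying \<open>class_map\<close> followed by this section does not change the homology class of a chain
  (\<open>wide_class_rep_map\<close>), because homology classes of pairs are constant on equivalence classes and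
  vanish on trivial pairs.
\<close>

section \<open>Linear maps and quotient modules\<close>

lemma (in abelian_group) minus_eq_zero_iff:
  assumes "x \<in> carrier G" "y \<in> carrier G"
  shows "x \<ominus> y = \<zero> \<longleftrightarrow> x = y"
  using assms by (metis minus_eq a_inv_closed minus_equality minus_minus r_neg)

lemma (in module) submodule_zero: "submodule {\<zero>\<^bsub>M\<^esub>} R M"
  by (rule submoduleI) auto

locale module_map = M: module K M + N: module K N
  for K :: "('k, 'm) ring_scheme" and M :: "('k, 'b, 'e) module_scheme"
    and N :: "('k, 'c, 'f) module_scheme" +
  fixes f :: "'b \<Rightarrow> 'c"
  assumes closed: "x \<in> carrier M \<Longrightarrow> f x \<in> carrier N"
    and add: "\<lbrakk>x \<in> carrier M; y \<in> carrier M\<rbrakk> \<Longrightarrow> f (x \<oplus>\<^bsub>M\<^esub> y) = f x \<oplus>\<^bsub>N\<^esub> f y"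
    and smult: "\<lbrakk>a \<in> carrier K; x \<in> carrier M\<rbrakk> \<Longrightarrow> f (a \<odot>\<^bsub>M\<^esub> x) = a \<odot>\<^bsub>N\<^esub> f x"
begin

lemma zero: "f \<zero>\<^bsub>M\<^esub> = \<zero>\<^bsub>N\<^esub>"
  using smult[of "\<zero>\<^bsub>K\<^esub>" "\<zero>\<^bsub>M\<^esub>"] closed[of "\<zero>\<^bsub>M\<^esub>"] by simp

lemma neg:
  assumes "x \<in> carrier M" shows "f (\<ominus>\<^bsub>M\<^esub> x) = \<ominus>\<^bsub>N\<^esub> f x"
proof -
  have "f (\<ominus>\<^bsub>M\<^esub> x) \<oplus>\<^bsub>N\<^esub> f x = \<zero>\<^bsub>N\<^esub>"
    using assms add[of "\<ominus>\<^bsub>M\<^esub> x" x] zero by (simp add: M.l_neg)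
  then show ?thesis
    using assms closed by (metis M.a_inv_closed N.minus_equality)
qed

lemma diff:
  "\<lbrakk>x \<in> carrier M; y \<in> carrier M\<rbrakk> \<Longrightarrow> f (x \<ominus>\<^bsub>M\<^esub> y) = f x \<ominus>\<^bsub>N\<^esub> f y"
  by (simp add: M.M.minus_eq N.M.minus_eq add neg)

lemma submodule_image:
  assumes "submodule H K M" shows "submodule (f ` H) K N"
proof (rule N.submoduleI)
  note H = M.submoduleE[OF assms]
  have sub: "x \<in> carrier M" if "x \<in> H" for x
    using that H(1) by blast
  have z: "\<zero>\<^bsub>M\<^esub> \<in> H"
    using subgroup.one_closed[OF submodule.axioms(1)[OF assms]] by simp
  show "f ` H \<subseteq> carrier N" using sub closed by blast
  show "\<zero>\<^bsub>N\<^esub> \<in> f ` H" using z zero by force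
  show "\<ominus>\<^bsub>N\<^esub> a \<in> f ` H" if "a \<in> f ` H" for a
    using that H(3) neg sub by (metis (no_types, lifting) image_iff)
  show "a \<oplus>\<^bsub>N\<^esub> b \<in> f ` H" if "a \<in> f ` H" "b \<in> f ` H" for a b
    using that H(5) add sub by (smt (verit) image_iff)
  show "a \<odot>\<^bsub>N\<^esub> b \<in> f ` H" if "a \<in> carrier K" "b \<in> f ` H" for a b
    using that H(4) smult sub by (metis (no_types, lifting) image_iff)
qed

lemma submodule_vimage:
  assumes "submodule H K N" shows "submodule {x \<in> carrier M. f x \<in> H} K M"
proof (rule M.submoduleI)
  note H = N.submoduleE[OF assms]
  have z: "\<zero>\<^bsub>N\<^esub> \<in> H"
    using subgroup.one_closed[OF submodule.axioms(1)[OF assms]] by simp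
  then show "\<zero>\<^bsub>M\<^esub> \<in> {x \<in> carrier M. f x \<in> H}" by (simp add: zero)
qed (use N.submoduleE[OF assms] in \<open>auto simp: neg add smult\<close>)

end

lemma module_map_comp:
  assumes "module_map K M N f" and "module_map K N P g"
  shows "module_map K M P (\<lambda>x. g (f x))"
proof -
  interpret f: module_map K M N f by fact
  interpret g: module_map K N P g by fact
  show ?thesis
    by unfold_locales (simp_all add: f.closed g.closed f.add g.add f.smult g.smult)
qed

text \<open>Both targets are the quotient of the source by the common kernel. The isomorphism is written
  down directly, by lifting along the first map and then applying the second.\<close>

lemma isomorphic_modules_of_same_kernel:
  assumes "module_map K M P p" and "module_map K M Q q"
    and "p ` carrier M = carrier P" and "q ` carrier M = carrier Q"
    and ker: "\<And>x. x \<in> carrier M \<Longrightarrow> p x = \<zero>\<^bsub>P\<^esub> \<longleftrightarrow> q x = \<zero>\<^bsub>Q\<^esub>"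
  shows "isomorphic_modules K P Q"
proof -
  interpret p: module_map K M P p by fact
  interpret q: module_map K M Q q by fact
  have eq: "p x = p y \<longleftrightarrow> q x = q y" if "x \<in> carrier M" "y \<in> carrier M" for x y
    using that ker[of "x \<ominus>\<^bsub>M\<^esub> y"] p.closed q.closed
    by (simp add: p.diff q.diff p.N.minus_eq_zero_iff q.N.minus_eq_zero_iff)
  define s where "s = inv_into (carrier M) p"
  have s: "s u \<in> carrier M" "p (s u) = u" if "u \<in> carrier P" for u
    using that assms(3) by (auto simp: s_def inv_into_into f_inv_into_f)
  have h: "q (s (p x)) = q x" if "x \<in> carrier M" for x
    using that s[of "p x"] p.closed eq by blast
  have "(\<lambda>u. q (s u)) \<in> module_isos K P Q"
    unfolding module_isos_def
  proof (intro CollectI conjI ballI)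
    show "bij_betw (\<lambda>u. q (s u)) (carrier P) (carrier Q)"
    proof (rule bij_betw_imageI)
      show "inj_on (\<lambda>u. q (s u)) (carrier P)"
        by (rule inj_onI) (metis s eq)
      show "(\<lambda>u. q (s u)) ` carrier P = carrier Q"
        unfolding assms(3)[symmetric] assms(4)[symmetric] using h by force
    qed
  next
    fix u v assume u: "u \<in> carrier P" and v: "v \<in> carrier P"
    show "q (s (u \<oplus>\<^bsub>P\<^esub> v)) = q (s u) \<oplus>\<^bsub>Q\<^esub> q (s v)"
      using h[of "s u \<oplus>\<^bsub>M\<^esub> s v"] s[OF u] s[OF v] by (simp add: p.add q.add)
  next
    fix a u assume a: "a \<in> carrier K" and u: "u \<in> carrier P"
    show "q (s (a \<odot>\<^bsub>P\<^esub> u)) = a \<odot>\<^bsub>Q\<^esub> q (s u)"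
      using h[of "a \<odot>\<^bsub>M\<^esub> s u"] s[OF u] a by (simp add: p.smult q.smult)
  qed
  then show ?thesis
    unfolding isomorphic_modules_def using p.N.module_axioms q.N.module_axioms by blast
qed

locale module_quotient = module K M
  for K :: "('k, 'm) ring_scheme" and M :: "('k, 'b, 'e) module_scheme" +
  fixes N :: "'b set"
  assumes sub: "submodule N K M"
begin

sublocale abelian_subgroup N M
  using submodule.axioms(1)[OF sub] additive_subgroup.intro abelian_subgroupI3 M.abelian_group_axioms
  by blast

lemma coset_eq_iff:
  assumes "x \<in> carrier M" "y \<in> carrier M"
  shows "N +>\<^bsub>M\<^esub> x = N +>\<^bsub>M\<^esub> y \<longleftrightarrow> x \<ominus>\<^bsub>M\<^esub> y \<in> N"
  using assms a_rcos_module[OF assms(2,1)]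
  by (metis a_rcos_self a_repr_independence' M.minus_eq)

lemma coset_eq_sub_iff:
  assumes "x \<in> carrier M" shows "N +>\<^bsub>M\<^esub> x = N \<longleftrightarrow> x \<in> N"
  using assms M.a_coset_join2 a_rcos_self submodule.axioms(1)[OF sub] by metis

lemma carrier_quot: "carrier (quot_module M N) = (\<lambda>x. N +>\<^bsub>M\<^esub> x) ` carrier M"
  by (auto simp: quot_module_def A_RCOSETS_def' image_iff)

text \<open>This turns the union over all representatives in \<open>quot_map\<close> into a value at one of them, so that
  every induced map of the complex can be computed on chains.\<close>

lemma quot_map_coset:
  assumes "module_quotient K M' N'" and "x \<in> carrier M"
    and closed: "\<And>x. x \<in> carrier M \<Longrightarrow> f x \<in> carrier M'"
    and add: "\<And>x y. \<lbrakk>x \<in> carrier M; y \<in> carrier M\<rbrakk> \<Longrightarrow> f (x \<oplus>\<^bsub>M\<^esub> y) = f x \<oplus>\<^bsub>M'\<^esub> f y"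
    and NN': "\<And>x. x \<in> N \<Longrightarrow> f x \<in> N'"
  shows "quot_map M' N' f (N +>\<^bsub>M\<^esub> x) = N' +>\<^bsub>M'\<^esub> f x"
proof -
  interpret Q: module_quotient K M' N' by fact
  have "N' +>\<^bsub>M'\<^esub> f z = N' +>\<^bsub>M'\<^esub> f x" if "z \<in> N +>\<^bsub>M\<^esub> x" for z
  proof -
    obtain n where n: "n \<in> N" "z = n \<oplus>\<^bsub>M\<^esub> x"
      using \<open>z \<in> _\<close> by (auto simp: a_r_coset_def')
    then have "f z = f n \<oplus>\<^bsub>M'\<^esub> f x"
      using add assms(2) by simp
    moreover have "f n \<oplus>\<^bsub>M'\<^esub> f x \<in> N' +>\<^bsub>M'\<^esub> f x"
      using NN'[OF n(1)] by (auto simp: a_r_coset_def')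
    ultimately show ?thesis
      using Q.a_repr_independence' closed[OF assms(2)] by metis
  qed
  moreover have "x \<in> N +>\<^bsub>M\<^esub> x" using a_rcos_self assms(2) by blast
  ultimately show ?thesis unfolding quot_map_def by blast
qed

lemma smult_coset:
  assumes "a \<in> carrier K" "x \<in> carrier M"
  shows "a \<odot>\<^bsub>quot_module M N\<^esub> (N +>\<^bsub>M\<^esub> x) = N +>\<^bsub>M\<^esub> (a \<odot>\<^bsub>M\<^esub> x)"
  using quot_map_coset[OF module_quotient_axioms assms(2), of "\<lambda>x. a \<odot>\<^bsub>M\<^esub> x"] assms
    submoduleE(4)[OF sub] smult_r_distr
  by (simp add: quot_module_def)

lemma add_coset:
  assumes "x \<in> carrier M" "y \<in> carrier M"
  shows "(N +>\<^bsub>M\<^esub> x) \<oplus>\<^bsub>quot_module M N\<^esub> (N +>\<^bsub>M\<^esub> y) = N +>\<^bsub>M\<^esub> (x \<oplus>\<^bsub>M\<^esub> y)"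
  using assms by (simp add: quot_module_def a_rcos_sum)

lemma zero_quot: "\<zero>\<^bsub>quot_module M N\<^esub> = N"
  by (simp add: quot_module_def)

lemma coset_zero: "N +>\<^bsub>M\<^esub> \<zero>\<^bsub>M\<^esub> = \<zero>\<^bsub>quot_module M N\<^esub>"
  by (simp add: zero_quot coset_eq_sub_iff)

lemma module_quot: "module K (quot_module M N)"
proof (rule moduleI)
  show "cring K" by (rule R.is_cring)
  show "abelian_group (quot_module M N)"
  proof (rule abelian_groupI)
    show "\<zero>\<^bsub>quot_module M N\<^esub> \<in> carrier (quot_module M N)"
      using coset_zero by (auto simp: carrier_quot)
    show "\<exists>y\<in>carrier (quot_module M N). y \<oplus>\<^bsub>quot_module M N\<^esub> x = \<zero>\<^bsub>quot_module M N\<^esub>"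
      if x: "x \<in> carrier (quot_module M N)" for x
    proof -
      obtain z where "z \<in> carrier M" "x = N +>\<^bsub>M\<^esub> z" using x by (auto simp: carrier_quot)
      then show ?thesis
        using coset_zero add_coset[of "\<ominus>\<^bsub>M\<^esub> z" z]
        by (intro bexI[of _ "N +>\<^bsub>M\<^esub> (\<ominus>\<^bsub>M\<^esub> z)"]) (auto simp: carrier_quot M.l_neg)
    qed
    show "\<zero>\<^bsub>quot_module M N\<^esub> \<oplus>\<^bsub>quot_module M N\<^esub> x = x"
      if "x \<in> carrier (quot_module M N)" for x
      using that add_coset[OF M.zero_closed] by (auto simp: carrier_quot coset_zero)
  qed (auto simp: carrier_quot add_coset M.a_ac)
qed (auto simp: carrier_quot smult_coset add_coset smult_l_distr smult_r_distr smult_assoc1)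

lemma quot_proj: "module_map K M (quot_module M N) (\<lambda>x. N +>\<^bsub>M\<^esub> x)"
  using module_axioms module_quot
  by (auto intro!: module_map.intro module_map_axioms.intro
      simp: carrier_quot add_coset smult_coset)

end

section \<open>Free modules\<close>

definition free_basis :: "('k, 'm) ring_scheme \<Rightarrow> 'b \<Rightarrow> 'b \<Rightarrow> 'k" where
  "free_basis K s = (\<lambda>x. if x = s then \<one>\<^bsub>K\<^esub> else \<zero>\<^bsub>K\<^esub>)"

text \<open>The linear extension of a map given on basis elements; the differential of the chain complex
  is an instance.\<close>

definition free_lift :: "('k, 'm) ring_scheme \<Rightarrow> ('k, 'c, 'e) module_scheme \<Rightarrow> ('b \<Rightarrow> 'c) \<Rightarrow> ('b \<Rightarrow> 'k) \<Rightarrow> 'c"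
  where "free_lift K M \<phi> c = (\<Oplus>\<^bsub>M\<^esub> s\<in>{s. c s \<noteq> \<zero>\<^bsub>K\<^esub>}. c s \<odot>\<^bsub>M\<^esub> \<phi> s)"

lemma free_module_simps:
  "\<zero>\<^bsub>free_module K S\<^esub> = (\<lambda>_. \<zero>\<^bsub>K\<^esub>)"
  "f \<oplus>\<^bsub>free_module K S\<^esub> g = (\<lambda>x. f x \<oplus>\<^bsub>K\<^esub> g x)"
  "a \<odot>\<^bsub>free_module K S\<^esub> f = (\<lambda>x. a \<otimes>\<^bsub>K\<^esub> f x)"
  by (simp_all add: free_module_def)

lemma free_module_carrier_iff:
  "f \<in> carrier (free_module K S) \<longleftrightarrow>
    (\<forall>x. f x \<in> carrier K) \<and> (\<forall>x. f x \<noteq> \<zero>\<^bsub>K\<^esub> \<longrightarrow> x \<in> S) \<and> finite {x. f x \<noteq> \<zero>\<^bsub>K\<^esub>}"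
  by (auto simp: free_module_def)

lemma free_module_carrier_mono:
  "S \<subseteq> T \<Longrightarrow> carrier (free_module K S) \<subseteq> carrier (free_module K T)"
  unfolding free_module_carrier_iff by (intro subsetI) (auto simp: free_module_carrier_iff)

context cring
begin

lemma module_free_module: "module R (free_module R S)"
proof (rule moduleI)
  have fin: "finite {x. f x \<oplus> g x \<noteq> \<zero>}"
    if "finite {x. f x \<noteq> \<zero>}" "finite {x. g x \<noteq> \<zero>}" for f g :: "'c \<Rightarrow> 'a"
    by (rule finite_subset[OF _ finite_UnI[OF that]]) auto
  have supp: "x \<in> S" if "f x \<oplus> g x \<noteq> \<zero>" "\<forall>x. f x \<noteq> \<zero> \<longrightarrow> x \<in> S" "\<forall>x. g x \<noteq> \<zero> \<longrightarrow> x \<in> S"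
    for f g :: "'c \<Rightarrow> 'a" and x
    using that by (cases "f x = \<zero>"; cases "g x = \<zero>") auto
  show "abelian_group (free_module R S)"
  proof (rule abelian_groupI)
    show "\<exists>g\<in>carrier (free_module R S). g \<oplus>\<^bsub>free_module R S\<^esub> f = \<zero>\<^bsub>free_module R S\<^esub>"
      if "f \<in> carrier (free_module R S)" for f
    proof (rule bexI[of _ "\<lambda>x. \<ominus> f x"])
      show "(\<lambda>x. \<ominus> f x) \<in> carrier (free_module R S)"
        using that by (auto simp: free_module_carrier_iff
            elim!: rev_finite_subset)
    qed (use that in \<open>auto simp: free_module_carrier_iff free_module_simps l_neg\<close>)
  qed (auto simp: free_module_carrier_iff free_module_simps fin supp a_assoc a_comm a_lcomm)
  show "a \<odot>\<^bsub>free_module R S\<^esub> f \<in> carrier (free_module R S)"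
    if "a \<in> carrier R" "f \<in> carrier (free_module R S)" for a f
  proof -
    have "{x. a \<otimes> f x \<noteq> \<zero>} \<subseteq> {x. f x \<noteq> \<zero>}" using that by auto
    then show ?thesis
      using that by (auto simp: free_module_carrier_iff free_module_simps dest: finite_subset)
  qed
qed (auto simp: free_module_carrier_iff free_module_simps l_distr r_distr m_assoc is_cring)

lemma free_module_neg:
  assumes "f \<in> carrier (free_module R S)"
  shows "\<ominus>\<^bsub>free_module R S\<^esub> f = (\<lambda>x. \<ominus> f x)"
proof -
  interpret F: module R "free_module R S" by (rule module_free_module)
  have "\<ominus>\<^bsub>free_module R S\<^esub> f = (\<ominus> \<one>) \<odot>\<^bsub>free_module R S\<^esub> f"
    using F.smult_l_minus[of \<one> f] assms by simp
  then show ?thesis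
    using assms by (simp add: free_module_simps free_module_carrier_iff l_minus)
qed

lemma free_module_inclusion_map:
  assumes "S \<subseteq> T"
  shows "module_map R (free_module R S) (free_module R T) (\<lambda>c. c)"
  using free_module_carrier_mono[OF assms, of R] module_free_module
  by (intro module_map.intro module_map_axioms.intro) (auto simp: free_module_simps)

lemma free_basis_closed: "s \<in> S \<Longrightarrow> free_basis R s \<in> carrier (free_module R S)"
  by (auto simp: free_module_carrier_iff free_basis_def)

text \<open>Remove the elements of the finite support one at a time.\<close>

lemma free_module_induct [consumes 1, case_names zero add]:
  assumes "c \<in> carrier (free_module R S)"
    and zero: "P \<zero>\<^bsub>free_module R S\<^esub>"
    and step: "\<And>a s c. \<lbrakk>a \<in> carrier R; s \<in> S; c \<in> carrier (free_module R S); P c\<rbrakk>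
      \<Longrightarrow> P ((a \<odot>\<^bsub>free_module R S\<^esub> free_basis R s) \<oplus>\<^bsub>free_module R S\<^esub> c)"
  shows "P c"
proof -
  have "finite {x. c x \<noteq> \<zero>}" using assms(1) by (simp add: free_module_carrier_iff)
  then show ?thesis using assms(1)
  proof (induction "{x. c x \<noteq> \<zero>}" arbitrary: c rule: finite_induct)
    case empty
    then have "c = \<zero>\<^bsub>free_module R S\<^esub>" by (auto simp: free_module_simps)
    then show ?case using zero by simp
  next
    case (insert s F)
    define c' where "c' = c(s := \<zero>)"
    have F: "F = {x. c' x \<noteq> \<zero>}" using insert(2,4) by (auto simp: c'_def)
    have c': "c' \<in> carrier (free_module R S)"
      using insert.prems F insert(1) by (auto simp: free_module_carrier_iff c'_def)
    have "s \<in> S" "c s \<in> carrier R"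
      using insert.prems insert(4) by (auto simp: free_module_carrier_iff)
    moreover have "c = c s \<odot>\<^bsub>free_module R S\<^esub> free_basis R s \<oplus>\<^bsub>free_module R S\<^esub> c'"
      using insert.prems by (auto simp: free_module_carrier_iff free_module_simps c'_def free_basis_def fun_eq_iff)
    ultimately show ?case using step[OF _ _ c' insert(3)[OF F c']] by metis
  qed
qed

text \<open>Additivity of \<open>free_lift\<close> needs both summands written as sums over a common index set, since the
  supports of two functions and of their sum may all differ.\<close>

lemma free_lift_eq:
  assumes "module R M" and "\<And>s. s \<in> S \<Longrightarrow> \<phi> s \<in> carrier M" and "c \<in> carrier (free_module R S)"
    and "finite A" "A \<subseteq> S" "{s. c s \<noteq> \<zero>} \<subseteq> A"
  shows "free_lift R M \<phi> c = (\<Oplus>\<^bsub>M\<^esub> s\<in>A. c s \<odot>\<^bsub>M\<^esub> \<phi> s)"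
proof -
  interpret M: module R M by fact
  show ?thesis
    unfolding free_lift_def
    by (rule M.add.finprod_mono_neutral_cong_left)
       (use assms(3-6) in \<open>auto simp: free_module_carrier_iff intro!: assms(2) M.smult_l_null\<close>)
qed

lemma free_lift_map:
  assumes "module R M" and \<phi>: "\<And>s. s \<in> S \<Longrightarrow> \<phi> s \<in> carrier M"
  shows "module_map R (free_module R S) M (free_lift R M \<phi>)"
proof -
  interpret M: module R M by fact
  interpret F: module R "free_module R S" by (rule module_free_module)
  have lift: "free_lift R M \<phi> c = (\<Oplus>\<^bsub>M\<^esub> s\<in>A. c s \<odot>\<^bsub>M\<^esub> \<phi> s)"
    if "c \<in> carrier (free_module R S)" "finite A" "A \<subseteq> S" "{s. c s \<noteq> \<zero>} \<subseteq> A" for c A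
    using that assms by (intro free_lift_eq[where S = S]) auto
  note iff = free_module_carrier_iff[where K = R]
  show ?thesis
  proof unfold_locales
    fix c assume c: "c \<in> carrier (free_module R S)"
    show "free_lift R M \<phi> c \<in> carrier M"
      unfolding free_lift_def using c \<phi> by (auto simp: iff intro!: M.finsum_closed)
  next
    fix c e assume c: "c \<in> carrier (free_module R S)" and e: "e \<in> carrier (free_module R S)"
    let ?A = "{s. c s \<noteq> \<zero>} \<union> {s. e s \<noteq> \<zero>}"
    have A: "finite ?A" "?A \<subseteq> S" using c e by (auto simp: iff)
    have \<phi>A: "\<phi> s \<in> carrier M" if "s \<in> ?A" for s using that A(2) \<phi> by blast
    have sub: "{s. (c \<oplus>\<^bsub>free_module R S\<^esub> e) s \<noteq> \<zero>} \<subseteq> ?A"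
      by (auto simp: free_module_simps)
    have "free_lift R M \<phi> (c \<oplus>\<^bsub>free_module R S\<^esub> e)
        = (\<Oplus>\<^bsub>M\<^esub> s\<in>?A. (c \<oplus>\<^bsub>free_module R S\<^esub> e) s \<odot>\<^bsub>M\<^esub> \<phi> s)"
      using c e A sub by (intro lift) auto
    also have "\<dots> = (\<Oplus>\<^bsub>M\<^esub> s\<in>?A. c s \<odot>\<^bsub>M\<^esub> \<phi> s \<oplus>\<^bsub>M\<^esub> e s \<odot>\<^bsub>M\<^esub> \<phi> s)"
      using c e by (intro M.finsum_cong') (auto simp: \<phi>A free_module_simps iff M.smult_l_distr)
    also have "\<dots> = (\<Oplus>\<^bsub>M\<^esub> s\<in>?A. c s \<odot>\<^bsub>M\<^esub> \<phi> s) \<oplus>\<^bsub>M\<^esub> (\<Oplus>\<^bsub>M\<^esub> s\<in>?A. e s \<odot>\<^bsub>M\<^esub> \<phi> s)"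
      using c e by (intro M.finsum_addf) (auto simp: \<phi>A iff)
    also have "\<dots> = free_lift R M \<phi> c \<oplus>\<^bsub>M\<^esub> free_lift R M \<phi> e"
      using lift[OF c A] lift[OF e A] by auto
    finally show "free_lift R M \<phi> (c \<oplus>\<^bsub>free_module R S\<^esub> e)
        = free_lift R M \<phi> c \<oplus>\<^bsub>M\<^esub> free_lift R M \<phi> e" .
  next
    fix a c assume a: "a \<in> carrier R" and c: "c \<in> carrier (free_module R S)"
    let ?A = "{s. c s \<noteq> \<zero>}"
    have A: "finite ?A" "?A \<subseteq> S" using c by (auto simp: iff)
    have \<phi>A: "\<phi> s \<in> carrier M" if "s \<in> ?A" for s using that A(2) \<phi> by blast
    have sub: "{s. (a \<odot>\<^bsub>free_module R S\<^esub> c) s \<noteq> \<zero>} \<subseteq> ?A"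
      using a by (auto simp: free_module_simps)
    have "free_lift R M \<phi> (a \<odot>\<^bsub>free_module R S\<^esub> c)
        = (\<Oplus>\<^bsub>M\<^esub> s\<in>?A. (a \<odot>\<^bsub>free_module R S\<^esub> c) s \<odot>\<^bsub>M\<^esub> \<phi> s)"
      using a c A sub by (intro lift) auto
    also have "\<dots> = (\<Oplus>\<^bsub>M\<^esub> s\<in>?A. a \<odot>\<^bsub>M\<^esub> (c s \<odot>\<^bsub>M\<^esub> \<phi> s))"
      using a c by (intro M.finsum_cong') (auto simp: \<phi>A free_module_simps iff M.smult_assoc1)
    also have "\<dots> = a \<odot>\<^bsub>M\<^esub> (\<Oplus>\<^bsub>M\<^esub> s\<in>?A. c s \<odot>\<^bsub>M\<^esub> \<phi> s)"
      using a c A(1) by (intro M.finsum_smult_ldistr[symmetric]) (auto simp: \<phi>A iff)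
    finally show "free_lift R M \<phi> (a \<odot>\<^bsub>free_module R S\<^esub> c) = a \<odot>\<^bsub>M\<^esub> free_lift R M \<phi> c"
      by (simp add: free_lift_def)
  qed
qed

lemma free_lift_basis:
  assumes "module R M" and "\<And>s. s \<in> S \<Longrightarrow> \<phi> s \<in> carrier M" and "s \<in> S"
  shows "free_lift R M \<phi> (free_basis R s) = \<phi> s"
proof -
  interpret M: module R M by fact
  have "free_lift R M \<phi> (free_basis R s) = (\<Oplus>\<^bsub>M\<^esub> t\<in>{s}. free_basis R s t \<odot>\<^bsub>M\<^esub> \<phi> t)"
    using assms
    by (intro free_lift_eq[where S = S])
      (auto simp: free_basis_closed, auto simp: free_basis_def split: if_splits)
  also have "\<dots> = \<phi> s"
  proof -
    have "\<phi> s \<in> carrier M" using assms by auto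
    then show ?thesis by (simp add: free_basis_def)
  qed
  finally show ?thesis .
qed

text \<open>The next two lemmas reduce statements about chains to statements about tuples.\<close>

lemma module_map_into_submodule:
  assumes "module_map R (free_module R S) M f" and H: "submodule H R M"
    and "\<And>s. s \<in> S \<Longrightarrow> f (free_basis R s) \<in> H"
    and "c \<in> carrier (free_module R S)"
  shows "f c \<in> H"
proof -
  interpret f: module_map R "free_module R S" M f by fact
  note H = f.N.submoduleE[OF H]
  have "\<zero>\<^bsub>M\<^esub> \<in> H"
    using subgroup.one_closed[OF submodule.axioms(1)[OF assms(2)]] by simp
  with assms(4) show ?thesis
  proof (induction rule: free_module_induct)
    case zero then show ?case by (simp add: f.zero)
  next
    case (add a s c)
    then show ?case
      using H assms(3) by (simp add: f.add f.smult free_basis_closed)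
  qed
qed

lemma module_map_eqI:
  assumes "module_map R (free_module R S) M f" and "module_map R (free_module R S) M g"
    and "\<And>s. s \<in> S \<Longrightarrow> f (free_basis R s) = g (free_basis R s)"
    and "c \<in> carrier (free_module R S)"
  shows "f c = g c"
proof -
  interpret f: module_map R "free_module R S" M f by fact
  interpret g: module_map R "free_module R S" M g by fact
  from assms(4) show ?thesis
  proof (induction rule: free_module_induct)
    case zero then show ?case by (simp add: f.zero g.zero)
  next
    case (add a s c)
    then show ?case
      using assms(3) by (simp add: f.add f.smult g.add g.smult free_basis_closed)
  qed
qed

lemma submodule_free_module:
  assumes "T \<subseteq> S" shows "submodule (carrier (free_module R T)) R (free_module R S)"
proof -
  interpret F: module R "free_module R S" by (rule module_free_module)
  have eq: "free_module R S\<lparr>carrier := carrier (free_module R T)\<rparr> = free_module R T"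
    by (simp add: free_module_def)
  show ?thesis
    by (rule F.module_incl_imp_submodule[OF free_module_carrier_mono[OF assms]])
      (simp only: eq module_free_module)
qed

end

section \<open>The filtered chain complex in low degrees\<close>

text \<open>The degree 1 has to survive simplification as an index, as facts about chains mention it.\<close>

declare One_nat_def [simp del]

definition short_tuples ::
  "'a set \<Rightarrow> ('a \<Rightarrow> 'a \<Rightarrow> ereal) \<Rightarrow> real set \<Rightarrow> nat \<Rightarrow> 'a list set" where
  "short_tuples X d T n = {xs \<in> tuples X d n. \<exists>s\<in>T. path_length d xs \<le> ereal s}"

abbreviation short_chains ::
  "('k, 'm) ring_scheme \<Rightarrow> 'a set \<Rightarrow> ('a \<Rightarrow> 'a \<Rightarrow> ereal) \<Rightarrow> real set \<Rightarrow> nat \<Rightarrow> ('k, 'a list \<Rightarrow> 'k) module"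
where
  "short_chains K X d T n \<equiv> free_module K (short_tuples X d T n)"

lemma short_tuples_mono: "S \<subseteq> T \<Longrightarrow> short_tuples X d S n \<subseteq> short_tuples X d T n"
  by (auto simp: short_tuples_def)

text \<open>A chain has finite support, so one of the finitely many bounds for its tuples serves for all of
  them. Thus each filtration step is itself free on a set of tuples.\<close>

lemma RC_filt_set_eq:
  assumes "cring K"
  shows "RC_filt_set K X d T n = carrier (short_chains K X d T n)"
proof (intro equalityI subsetI)
  interpret cring K by fact
  fix c assume "c \<in> RC_filt_set K X d T n"
  then show "c \<in> carrier (short_chains K X d T n)"
    by (auto simp: RC_filt_set_def RC_filt_def RC_def short_tuples_def
        free_module_simps free_module_carrier_iff)
next
  interpret cring K by fact
  fix c assume c: "c \<in> carrier (short_chains K X d T n)"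
  let ?S = "{xs. c xs \<noteq> \<zero>\<^bsub>K\<^esub>}"
  show "c \<in> RC_filt_set K X d T n"
  proof (cases "?S = {}")
    case True
    then show ?thesis by (auto simp: RC_filt_set_def RC_def free_module_simps)
  next
    case False
    have fin: "finite ?S" and sub: "?S \<subseteq> short_tuples X d T n"
      using c by (auto simp: free_module_carrier_iff)
    then have "\<forall>xs\<in>?S. \<exists>s\<in>T. path_length d xs \<le> ereal s"
      by (auto simp: short_tuples_def)
    then obtain s where s: "\<And>xs. xs \<in> ?S \<Longrightarrow> s xs \<in> T \<and> path_length d xs \<le> ereal (s xs)"
      by metis
    let ?m = "Max (s ` ?S)"
    have "?m \<in> s ` ?S" using fin False by (intro Max_in) auto
    then obtain ys where "?m = s ys" "ys \<in> ?S" by (rule imageE)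
    then have "?m \<in> T" using s[of ys] by (simp only:)
    moreover have "path_length d xs \<le> ereal ?m" if "xs \<in> ?S" for xs
    proof -
      have "s xs \<le> ?m" using fin that by (intro Max_ge) auto
      then show ?thesis using s[OF that] by (meson ereal_less_eq(3) order_trans)
    qed
    moreover have "c \<in> carrier (RC K X d n)"
      using c by (auto simp: RC_def free_module_carrier_iff short_tuples_def)
    ultimately show ?thesis by (auto simp: RC_filt_set_def RC_filt_def)
  qed
qed

lemma free_module_restrict_codomain:
  assumes "cring K" and "module_map K M (free_module K T) f"
    and "\<And>x. x \<in> carrier M \<Longrightarrow> f x \<in> carrier (free_module K S)"
  shows "module_map K M (free_module K S) f"
proof -
  interpret f: module_map K M "free_module K T" f by fact
  show ?thesis
    using assms(3) f.add f.smult cring.module_free_module[OF assms(1)]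
    by (intro module_map.intro module_map_axioms.intro f.M.module_axioms)
      (auto simp: free_module_simps)
qed

lemma carrier_free_module_restrict:
  "free_module K S\<lparr>carrier := carrier (free_module K T)\<rparr> = free_module K T"
  by (simp add: free_module_def)

lemma RC_upper_eq:
  "cring K \<Longrightarrow> RC_upper K X d I n = short_chains K X d (int_R I) n"
  by (simp add: RC_upper_def RC_filt_set_eq RC_def carrier_free_module_restrict)

lemma RC_int_eq:
  "cring K \<Longrightarrow> RC_int K X d I n
    = quot_module (short_chains K X d (int_R I) n) (carrier (short_chains K X d (int_L I) n))"
  by (simp add: RC_int_def RC_upper_eq RC_filt_set_eq)

locale quasimetric_chains = cring K + quasimetric_space X d
  for K :: "('k, 'm) ring_scheme" and X :: "'a set" and d :: "'a \<Rightarrow> 'a \<Rightarrow> ereal"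
begin

lemma pair_short_iff:
  "[x, y] \<in> short_tuples X d T 1 \<longleftrightarrow> x \<in> X \<and> y \<in> X \<and> x \<noteq> y \<and> (\<exists>s\<in>T. d x y \<le> ereal s)"
  by (force simp: short_tuples_def tuples_def path_length_def)

lemma triple_short_iff:
  "[x, a, y] \<in> short_tuples X d T 2 \<longleftrightarrow> x \<in> X \<and> a \<in> X \<and> y \<in> X \<and> x \<noteq> a \<and> a \<noteq> y
    \<and> (\<exists>s\<in>T. d x a + d a y \<le> ereal s)"
proof -
  have "d x a < \<infinity> \<and> d a y < \<infinity>" if "x \<in> X" "a \<in> X" "y \<in> X" "d x a + d a y \<le> ereal s" for s
    using that nonneg[of x a] nonneg[of a y] by (cases "d x a"; cases "d a y") auto
  then show ?thesis
    by (auto simp: short_tuples_def tuples_def path_length_def numeral_2_eq_2)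
qed

lemma tuple_elt_eq: "distinct_adj xs \<Longrightarrow> tuple_elt K xs = free_basis K xs"
  by (simp add: tuple_elt_def free_basis_def)

lemma tuple_elt_closed:
  "(distinct_adj xs \<Longrightarrow> xs \<in> S) \<Longrightarrow> tuple_elt K xs \<in> carrier (free_module K S)"
  by (auto simp: tuple_elt_def free_module_carrier_iff)

lemma RC_diff_tuple_pair:
  assumes "x \<in> X" "y \<in> X"
  shows "RC_diff_tuple K X d 1 [x, y] \<in> carrier (RC K X d 0)"
proof -
  interpret F: module K "free_module K (tuples X d 0)" by (rule module_free_module)
  have "tuple_elt K (take i [x, y] @ drop (Suc i) [x, y]) \<in> carrier (free_module K (tuples X d 0))"
    if "i \<in> {..1}" for i
  proof -
    have "i = 0 \<or> i = 1" using that by auto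
    then have "take i [x, y] @ drop (Suc i) [x, y] \<in> tuples X d 0"
      using assms by (auto simp: tuples_def One_nat_def)
    then show ?thesis by (intro tuple_elt_closed)
  qed
  then show ?thesis
    unfolding RC_diff_tuple_def RC_def diff_self_eq_0
    by (intro F.finsum_closed Pi_I F.smult_closed) auto
qed

text \<open>The element \<open>tuple_elt K [x, y]\<close> is zero for \<open>x = y\<close>, so the formula covers \<open>(x, a, x)\<close> too.\<close>

lemma RC_diff_tuple_triple:
  assumes "x \<in> X" "a \<in> X" "y \<in> X" and "d x a < \<infinity>" "d a y < \<infinity>"
  shows "RC_diff_tuple K X d 2 [x, a, y] =
    tuple_elt K [a, y] \<oplus>\<^bsub>RC K X d 1\<^esub> tuple_elt K [x, a] \<ominus>\<^bsub>RC K X d 1\<^esub> tuple_elt K [x, y]"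
proof -
  interpret F: module K "RC K X d 1" unfolding RC_def by (rule module_free_module)
  have "d x y < \<infinity>"
    using triangle[of x a y] assms by (metis ereal_infty_less(1) ereal_plus_eq_PInfty order.strict_trans1)
  then have t: "tuple_elt K [a, y] \<in> carrier (RC K X d 1)" "tuple_elt K [x, a] \<in> carrier (RC K X d 1)"
      "tuple_elt K [x, y] \<in> carrier (RC K X d 1)"
    unfolding RC_def using assms by (auto intro!: tuple_elt_closed simp: tuples_def)
  define f where "f i = ((\<ominus>\<^bsub>K\<^esub> \<one>\<^bsub>K\<^esub>) [^]\<^bsub>K\<^esub> i)
    \<odot>\<^bsub>RC K X d 1\<^esub> tuple_elt K (take i [x, a, y] @ drop (Suc i) [x, a, y])" for i :: nat
  have 1: "(\<ominus>\<^bsub>K\<^esub> \<one>\<^bsub>K\<^esub>) [^]\<^bsub>K\<^esub> (1 :: nat) = \<ominus>\<^bsub>K\<^esub> \<one>\<^bsub>K\<^esub>" "take 1 [x, a, y] = [x]"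
    by (simp_all add: One_nat_def)
  have f: "f 0 = tuple_elt K [a, y]" "f 1 = \<ominus>\<^bsub>RC K X d 1\<^esub> tuple_elt K [x, y]" "f 2 = tuple_elt K [x, a]"
    using t by (simp_all add: f_def F.smult_l_minus 1 numeral_2_eq_2 l_minus)
  have "RC_diff_tuple K X d 2 [x, a, y] = (\<Oplus>\<^bsub>RC K X d 1\<^esub> i\<in>{..2}. f i)"
    unfolding RC_diff_tuple_def f_def by (simp add: One_nat_def)
  also have "{..2::nat} = {0, 1, 2}" by auto
  also have "(\<Oplus>\<^bsub>RC K X d 1\<^esub> i\<in>{0, 1, 2}. f i)
      = f 0 \<oplus>\<^bsub>RC K X d 1\<^esub> (f 1 \<oplus>\<^bsub>RC K X d 1\<^esub> f 2)"
    using t f by (simp add: Pi_def)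
  finally show ?thesis
    using t by (simp only: f) (simp add: F.minus_eq F.a_ac)
qed

lemma RC_diff_eq_lift:
  "n \<noteq> 0 \<Longrightarrow> RC_diff K X d n = free_lift K (RC K X d (n - 1)) (RC_diff_tuple K X d n)"
  by (simp add: RC_diff_def free_lift_def fun_eq_iff)

lemma pair_shape:
  assumes "xs \<in> short_tuples X d T 1"
  obtains x y where "xs = [x, y]" "[x, y] \<in> short_tuples X d T 1"
proof -
  have "length xs = Suc 1" using assms by (simp add: short_tuples_def tuples_def)
  then obtain x y where "xs = [x, y]" by (auto simp: length_Suc_conv One_nat_def)
  then show thesis using assms that by blast
qed

lemma triple_shape:
  assumes "xs \<in> short_tuples X d T 2"
  obtains x a y where "xs = [x, a, y]" "[x, a, y] \<in> short_tuples X d T 2"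
proof -
  have "length xs = Suc 2" using assms by (simp add: short_tuples_def tuples_def)
  then obtain x a y where "xs = [x, a, y]" by (auto simp: length_Suc_conv numeral_2_eq_2)
  then show thesis using assms that by blast
qed

text \<open>The triangle inequality makes the differential respect the filtration.\<close>

lemma triple_faces_short:
  assumes "[x, a, y] \<in> short_tuples X d T 2"
  shows "[x, a] \<in> short_tuples X d T 1" "[a, y] \<in> short_tuples X d T 1"
    "x \<noteq> y \<Longrightarrow> [x, y] \<in> short_tuples X d T 1"
proof -
  obtain s where s: "s \<in> T" "d x a + d a y \<le> ereal s" and X: "x \<in> X" "a \<in> X" "y \<in> X" "x \<noteq> a" "a \<noteq> y"
    using assms by (auto simp: triple_short_iff)
  have "d x a \<le> d x a + d a y" "d a y \<le> d x a + d a y"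
    using nonneg[of x a] nonneg[of a y] X by (auto simp: ereal_le_add_self ereal_le_add_self2)
  then show "[x, a] \<in> short_tuples X d T 1" "[a, y] \<in> short_tuples X d T 1"
    "x \<noteq> y \<Longrightarrow> [x, y] \<in> short_tuples X d T 1"
    using s X triangle[of x a y] unfolding pair_short_iff by (meson order_trans)+
qed

lemma RC_diff_map_1: "module_map K (short_chains K X d T 1) (RC K X d 0) (RC_diff K X d 1)"
proof -
  have "RC_diff_tuple K X d 1 xs \<in> carrier (RC K X d 0)" if "xs \<in> short_tuples X d T 1" for xs
    using that by (rule pair_shape) (auto simp: pair_short_iff intro: RC_diff_tuple_pair)
  moreover have "module K (RC K X d 0)" unfolding RC_def by (rule module_free_module)
  ultimately show ?thesis
    using RC_diff_eq_lift[of 1] by (simp add: free_lift_map)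
qed

text \<open>The differential is defined in the unfiltered complex; here it is rewritten with the operations
  of the filtration step, where the quotients are formed.\<close>

lemma
  assumes "[x, a, y] \<in> short_tuples X d T 2"
  shows RC_diff_tuple_triple_closed: "RC_diff_tuple K X d 2 [x, a, y] \<in> carrier (short_chains K X d T 1)"
    and RC_diff_tuple_triple': "RC_diff_tuple K X d 2 [x, a, y] = tuple_elt K [a, y]
      \<oplus>\<^bsub>short_chains K X d T 1\<^esub> tuple_elt K [x, a] \<ominus>\<^bsub>short_chains K X d T 1\<^esub> tuple_elt K [x, y]"
proof -
  interpret F: module K "RC K X d 1" unfolding RC_def by (rule module_free_module)
  have "short_tuples X d T 1 \<subseteq> tuples X d 1" by (auto simp: short_tuples_def)
  note sub = submodule_free_module[OF this]
  interpret S: module K "short_chains K X d T 1" by (rule module_free_module)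
  have X: "x \<in> X" "a \<in> X" "y \<in> X" "d x a < \<infinity>" "d a y < \<infinity>"
    using assms by (auto simp: short_tuples_def tuples_def)
  have t: "tuple_elt K [a, y] \<in> carrier (short_chains K X d T 1)"
      "tuple_elt K [x, a] \<in> carrier (short_chains K X d T 1)"
      "tuple_elt K [x, y] \<in> carrier (short_chains K X d T 1)"
    using triple_faces_short[OF assms] by (auto intro!: tuple_elt_closed)
  have neg: "\<ominus>\<^bsub>RC K X d 1\<^esub> u = \<ominus>\<^bsub>short_chains K X d T 1\<^esub> u" if "u \<in> carrier (short_chains K X d T 1)" for u
  proof -
    have "u \<in> carrier (free_module K (tuples X d 1))"
      using that F.submoduleE(1)[OF sub[folded RC_def]] unfolding RC_def by blast
    then show ?thesis unfolding RC_def by (simp only: free_module_neg that)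
  qed
  show "RC_diff_tuple K X d 2 [x, a, y] = tuple_elt K [a, y]
      \<oplus>\<^bsub>short_chains K X d T 1\<^esub> tuple_elt K [x, a] \<ominus>\<^bsub>short_chains K X d T 1\<^esub> tuple_elt K [x, y]"
    using neg[OF t(3)] by (simp add: RC_diff_tuple_triple[OF X] F.minus_eq S.minus_eq) (simp add: RC_def free_module_simps)
  then show "RC_diff_tuple K X d 2 [x, a, y] \<in> carrier (short_chains K X d T 1)"
    using t by simp
qed

lemma RC_diff_tuple_closed_2:
  assumes "xs \<in> short_tuples X d T 2"
  shows "RC_diff_tuple K X d 2 xs \<in> carrier (short_chains K X d T 1)"
proof -
  obtain x a y where "xs = [x, a, y]" "[x, a, y] \<in> short_tuples X d T 2"
    using triple_shape[OF assms] .
  then show ?thesis using RC_diff_tuple_triple_closed by simp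
qed

lemma short_chains_sub_RC: "submodule (carrier (short_chains K X d T n)) K (RC K X d n)"
  unfolding RC_def by (rule submodule_free_module) (auto simp: short_tuples_def)

lemma RC_diff_eq_lift_2: "RC_diff K X d 2 = free_lift K (RC K X d 1) (RC_diff_tuple K X d 2)"
  using RC_diff_eq_lift[of 2] by (simp add: One_nat_def)

lemma
  shows RC_diff_map_2:
      "module_map K (short_chains K X d T 2) (short_chains K X d T 1) (RC_diff K X d 2)"
    and RC_diff_basis: "xs \<in> short_tuples X d T 2
      \<Longrightarrow> RC_diff K X d 2 (free_basis K xs) = RC_diff_tuple K X d 2 xs"
proof -
  interpret RC: module K "RC K X d 1" unfolding RC_def by (rule module_free_module)
  have mem: "RC_diff_tuple K X d 2 xs \<in> carrier (RC K X d 1)" if "xs \<in> short_tuples X d T 2" for xs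
    using RC_diff_tuple_closed_2[OF that] RC.submoduleE(1)[OF short_chains_sub_RC] by blast
  have map: "module_map K (short_chains K X d T 2) (RC K X d 1) (RC_diff K X d 2)"
    unfolding RC_diff_eq_lift_2 by (rule free_lift_map[OF RC.module_axioms mem])
  show basis: "RC_diff K X d 2 (free_basis K xs) = RC_diff_tuple K X d 2 xs"
    if "xs \<in> short_tuples X d T 2" for xs
    unfolding RC_diff_eq_lift_2 by (rule free_lift_basis[OF RC.module_axioms mem that])
  show "module_map K (short_chains K X d T 2) (short_chains K X d T 1) (RC_diff K X d 2)"
  proof (rule free_module_restrict_codomain[OF is_cring map[unfolded RC_def]])
    fix c assume c: "c \<in> carrier (short_chains K X d T 2)"
    show "RC_diff K X d 2 c \<in> carrier (short_chains K X d T 1)"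
      by (rule module_map_into_submodule[OF map short_chains_sub_RC _ c])
        (simp add: basis RC_diff_tuple_closed_2)
  qed
qed

lemma RC_diff_basis_triple:
  assumes "[x, a, y] \<in> short_tuples X d T 2"
  shows "RC_diff K X d 2 (free_basis K [x, a, y]) = tuple_elt K [a, y]
      \<oplus>\<^bsub>short_chains K X d T 1\<^esub> tuple_elt K [x, a] \<ominus>\<^bsub>short_chains K X d T 1\<^esub> tuple_elt K [x, y]"
  using RC_diff_basis[OF assms] RC_diff_tuple_triple'[OF assms] by simp

end

section \<open>First homology of the filtration quotients\<close>

context quasimetric_chains
begin

text \<open>The homology class, in the complex of the interval \<open>I\<close>, of a chain of the upper filtration step.\<close>

definition H_class :: "real set \<Rightarrow> ('a list \<Rightarrow> 'k) \<Rightarrow> ('a list \<Rightarrow> 'k) set set" where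
  "H_class I c = boundaries (RC_int K X d I) (RC_int_diff K X d I) 1 +>\<^bsub>RC_int K X d I 1\<^esub>
    (RC_filt_set K X d (int_L I) 1 +>\<^bsub>RC_upper K X d I 1\<^esub> c)"

lemma module_quotient_chains:
  assumes "int_L I \<subseteq> int_R I"
  shows "module_quotient K (short_chains K X d (int_R I) n) (carrier (short_chains K X d (int_L I) n))"
  using module_free_module submodule_free_module[OF short_tuples_mono[OF assms]]
  by (intro module_quotient.intro module_quotient_axioms.intro)

text \<open>A tuple with a single point has length zero, so a filtration step that contains 0 contains all
  of degree 0. If the lower step of an interval does, its complex vanishes in degree 0.\<close>

lemma short_chains_0: "\<exists>s\<in>T. 0 \<le> s \<Longrightarrow> short_chains K X d T 0 = RC K X d 0"
  unfolding RC_def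
  by (rule arg_cong[of _ _ "free_module K"])
    (auto simp: short_tuples_def tuples_def length_Suc_conv path_length_def)

lemma cycles_1:
  assumes "int_L I \<subseteq> int_R I" and "0 \<in> int_L I"
  shows "cycles (RC_int K X d I) (RC_int_diff K X d I) 1 = carrier (RC_int K X d I 1)"
proof -
  interpret Q1: module_quotient K "short_chains K X d (int_R I) 1" "carrier (short_chains K X d (int_L I) 1)"
    using assms(1) by (rule module_quotient_chains)
  interpret Q0: module_quotient K "short_chains K X d (int_R I) 0" "carrier (short_chains K X d (int_L I) 0)"
    using assms(1) by (rule module_quotient_chains)
  interpret D: module_map K "short_chains K X d (int_R I) 1" "RC K X d 0" "RC_diff K X d 1"
    by (rule RC_diff_map_1)
  have 0: "short_chains K X d (int_R I) 0 = RC K X d 0" "short_chains K X d (int_L I) 0 = RC K X d 0"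
    using assms by (auto intro!: short_chains_0)
  have "RC_int_diff K X d I 1 A = \<zero>\<^bsub>RC_int K X d I 0\<^esub>" if A: "A \<in> carrier (RC_int K X d I 1)" for A
  proof -
    obtain c where c: "c \<in> carrier (short_chains K X d (int_R I) 1)"
      "A = carrier (short_chains K X d (int_L I) 1) +>\<^bsub>short_chains K X d (int_R I) 1\<^esub> c"
      using A by (auto simp: RC_int_eq[OF is_cring] Q1.carrier_quot)
    have "RC_int_diff K X d I 1 A = quot_map (short_chains K X d (int_R I) 0)
        (carrier (short_chains K X d (int_L I) 0)) (RC_diff K X d 1) A"
      by (simp add: RC_int_diff_def RC_upper_eq[OF is_cring] RC_filt_set_eq[OF is_cring])
    also have "\<dots> = carrier (short_chains K X d (int_L I) 0)
        +>\<^bsub>short_chains K X d (int_R I) 0\<^esub> RC_diff K X d 1 c"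
      unfolding c(2)
    proof (rule Q1.quot_map_coset[OF Q0.module_quotient_axioms c(1)])
      show "RC_diff K X d 1 x \<in> carrier (short_chains K X d (int_L I) 0)"
        if "x \<in> carrier (short_chains K X d (int_L I) 1)" for x
        using that D.closed Q1.a_subset by (auto simp: 0)
    qed (simp_all add: 0 D.closed D.add)
    also have "\<dots> = carrier (short_chains K X d (int_L I) 0)"
      using Q0.coset_eq_sub_iff c(1) D.closed by (simp add: 0)
    finally show ?thesis by (simp add: RC_int_eq[OF is_cring] Q0.zero_quot)
  qed
  then show ?thesis
    by (auto simp: cycles_def a_kernel_def')
qed

lemma H_int_1:
  assumes "int_L I \<subseteq> int_R I" and "0 \<in> int_L I"
  shows "H_int K X d I 1 = quot_module (RC_int K X d I 1) (boundaries (RC_int K X d I) (RC_int_diff K X d I) 1)"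
  unfolding H_int_def homology_def cycles_1[OF assms] by simp

lemma RC_int_diff_2:
  assumes "int_L I \<subseteq> int_R I" and e: "e \<in> carrier (short_chains K X d (int_R I) 2)"
  shows "RC_int_diff K X d I 2 (carrier (short_chains K X d (int_L I) 2) +>\<^bsub>short_chains K X d (int_R I) 2\<^esub> e)
    = carrier (short_chains K X d (int_L I) 1) +>\<^bsub>short_chains K X d (int_R I) 1\<^esub> RC_diff K X d 2 e"
proof -
  interpret Q1: module_quotient K "short_chains K X d (int_R I) 1" "carrier (short_chains K X d (int_L I) 1)"
    using assms(1) by (rule module_quotient_chains)
  interpret Q2: module_quotient K "short_chains K X d (int_R I) 2" "carrier (short_chains K X d (int_L I) 2)"
    using assms(1) by (rule module_quotient_chains)
  interpret D: module_map K "short_chains K X d (int_R I) 2" "short_chains K X d (int_R I) 1" "RC_diff K X d 2"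
    by (rule RC_diff_map_2)
  have 1: "(2 :: nat) - 1 = 1" by simp
  show ?thesis
    unfolding RC_int_diff_def 1 RC_upper_eq[OF is_cring] RC_filt_set_eq[OF is_cring]
    using module_map.closed[OF RC_diff_map_2]
    by (intro Q2.quot_map_coset[OF Q1.module_quotient_axioms e] D.closed D.add)
qed

lemma boundaries_1:
  assumes "int_L I \<subseteq> int_R I"
  shows "boundaries (RC_int K X d I) (RC_int_diff K X d I) 1 =
    (\<lambda>e. carrier (short_chains K X d (int_L I) 1) +>\<^bsub>short_chains K X d (int_R I) 1\<^esub> RC_diff K X d 2 e)
      ` carrier (short_chains K X d (int_R I) 2)"
proof -
  interpret Q2: module_quotient K "short_chains K X d (int_R I) 2" "carrier (short_chains K X d (int_L I) 2)"
    using assms(1) by (rule module_quotient_chains)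
  have 2: "Suc 1 = 2" by simp
  show ?thesis
    unfolding boundaries_def 2 RC_int_eq[OF is_cring] Q2.carrier_quot image_image
    using RC_int_diff_2[OF assms] by (rule image_cong[OF refl])
qed

lemma module_quotient_boundaries:
  assumes "int_L I \<subseteq> int_R I"
  shows "module_quotient K (RC_int K X d I 1) (boundaries (RC_int K X d I) (RC_int_diff K X d I) 1)"
proof -
  interpret Q1: module_quotient K "short_chains K X d (int_R I) 1" "carrier (short_chains K X d (int_L I) 1)"
    using assms(1) by (rule module_quotient_chains)
  interpret B: module_map K "short_chains K X d (int_R I) 2" "RC_int K X d I 1"
    "\<lambda>e. carrier (short_chains K X d (int_L I) 1) +>\<^bsub>short_chains K X d (int_R I) 1\<^esub> RC_diff K X d 2 e"
    unfolding RC_int_eq[OF is_cring] by (rule module_map_comp[OF RC_diff_map_2 Q1.quot_proj])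
  show ?thesis
    unfolding boundaries_1[OF assms]
    using B.N.module_axioms B.submodule_image[OF B.M.carrier_is_submodule]
    by (intro module_quotient.intro module_quotient_axioms.intro)
qed

text \<open>This presents the first homology as a quotient of a free module on pairs: a chain is zero in it
  when it is a boundary up to a chain of the lower filtration step.\<close>

lemma
  assumes "int_L I \<subseteq> int_R I" and "0 \<in> int_L I"
  shows H_class_map: "module_map K (short_chains K X d (int_R I) 1) (H_int K X d I 1) (H_class I)"
    and H_class_surj: "H_class I ` carrier (short_chains K X d (int_R I) 1) = carrier (H_int K X d I 1)"
    and H_class_zero_iff: "c \<in> carrier (short_chains K X d (int_R I) 1) \<Longrightarrow>
      H_class I c = \<zero>\<^bsub>H_int K X d I 1\<^esub> \<longleftrightarrow> (\<exists>e\<in>carrier (short_chains K X d (int_R I) 2).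
        c \<ominus>\<^bsub>short_chains K X d (int_R I) 1\<^esub> RC_diff K X d 2 e \<in> carrier (short_chains K X d (int_L I) 1))"
proof -
  interpret Q1: module_quotient K "short_chains K X d (int_R I) 1" "carrier (short_chains K X d (int_L I) 1)"
    using assms(1) by (rule module_quotient_chains)
  interpret B: module_quotient K "RC_int K X d I 1" "boundaries (RC_int K X d I) (RC_int_diff K X d I) 1"
    using assms(1) by (rule module_quotient_boundaries)
  interpret D: module_map K "short_chains K X d (int_R I) 2" "short_chains K X d (int_R I) 1" "RC_diff K X d 2"
    by (rule RC_diff_map_2)
  have eq: "H_class I c = boundaries (RC_int K X d I) (RC_int_diff K X d I) 1 +>\<^bsub>RC_int K X d I 1\<^esub>
    (carrier (short_chains K X d (int_L I) 1) +>\<^bsub>short_chains K X d (int_R I) 1\<^esub> c)" for c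
    by (simp add: H_class_def RC_filt_set_eq[OF is_cring] RC_upper_eq[OF is_cring])
  have carr: "carrier (RC_int K X d I 1) =
    (\<lambda>c. carrier (short_chains K X d (int_L I) 1) +>\<^bsub>short_chains K X d (int_R I) 1\<^esub> c)
      ` carrier (short_chains K X d (int_R I) 1)"
    by (simp add: RC_int_eq[OF is_cring] Q1.carrier_quot)
  show "module_map K (short_chains K X d (int_R I) 1) (H_int K X d I 1) (H_class I)"
    unfolding H_int_1[OF assms] eq[abs_def]
    by (rule module_map_comp[OF _ B.quot_proj]) (unfold RC_int_eq[OF is_cring], rule Q1.quot_proj)
  show "H_class I ` carrier (short_chains K X d (int_R I) 1) = carrier (H_int K X d I 1)"
    unfolding H_int_1[OF assms] B.carrier_quot carr image_image eq ..
  assume c: "c \<in> carrier (short_chains K X d (int_R I) 1)"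
  have "H_class I c = \<zero>\<^bsub>H_int K X d I 1\<^esub> \<longleftrightarrow>
    carrier (short_chains K X d (int_L I) 1) +>\<^bsub>short_chains K X d (int_R I) 1\<^esub> c
      \<in> boundaries (RC_int K X d I) (RC_int_diff K X d I) 1"
    unfolding H_int_1[OF assms] B.zero_quot eq
    using c by (intro B.coset_eq_sub_iff) (auto simp: carr)
  also have "\<dots> \<longleftrightarrow> (\<exists>e\<in>carrier (short_chains K X d (int_R I) 2).
        c \<ominus>\<^bsub>short_chains K X d (int_R I) 1\<^esub> RC_diff K X d 2 e \<in> carrier (short_chains K X d (int_L I) 1))"
    unfolding boundaries_1[OF assms(1)] image_iff
    using Q1.coset_eq_iff[OF c D.closed] by blast
  finally show "H_class I c = \<zero>\<^bsub>H_int K X d I 1\<^esub> \<longleftrightarrow> (\<exists>e\<in>carrier (short_chains K X d (int_R I) 2).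
        c \<ominus>\<^bsub>short_chains K X d (int_R I) 1\<^esub> RC_diff K X d 2 e \<in> carrier (short_chains K X d (int_L I) 1))" .
qed

lemma H_int_map_class:
  assumes I: "int_L I \<subseteq> int_R I"
    and J: "int_L J \<subseteq> int_R J" "0 \<in> int_L J"
    and R: "int_R I \<subseteq> int_R J" and L: "int_L I \<subseteq> int_L J"
    and c: "c \<in> carrier (short_chains K X d (int_R I) 1)"
  shows "H_int_map K X d J 1 (H_class I c) = H_class J c"
proof -
  interpret I1: module_quotient K "short_chains K X d (int_R I) 1" "carrier (short_chains K X d (int_L I) 1)"
    using I by (rule module_quotient_chains)
  interpret J1: module_quotient K "short_chains K X d (int_R J) 1" "carrier (short_chains K X d (int_L J) 1)"
    using J(1) by (rule module_quotient_chains)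
  interpret IB: module_quotient K "RC_int K X d I 1" "boundaries (RC_int K X d I) (RC_int_diff K X d I) 1"
    using I by (rule module_quotient_boundaries)
  interpret JB: module_quotient K "RC_int K X d J 1" "boundaries (RC_int K X d J) (RC_int_diff K X d J) 1"
    using J(1) by (rule module_quotient_boundaries)
  note upper = RC_upper_eq[OF is_cring] RC_filt_set_eq[OF is_cring]
  have sub: "carrier (short_chains K X d (int_R I) n) \<subseteq> carrier (short_chains K X d (int_R J) n)"
    "carrier (short_chains K X d (int_L I) n) \<subseteq> carrier (short_chains K X d (int_L J) n)" for n
    using free_module_carrier_mono[OF short_tuples_mono[OF R]]
      free_module_carrier_mono[OF short_tuples_mono[OF L]] by blast+
  define \<iota> where "\<iota> = RC_int_map K X d J 1"
  have \<iota>: "\<iota> (carrier (short_chains K X d (int_L I) 1) +>\<^bsub>short_chains K X d (int_R I) 1\<^esub> u)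
      = carrier (short_chains K X d (int_L J) 1) +>\<^bsub>short_chains K X d (int_R J) 1\<^esub> u"
    if "u \<in> carrier (short_chains K X d (int_R I) 1)" for u
    unfolding \<iota>_def RC_int_map_def upper
    by (rule I1.quot_map_coset[OF J1.module_quotient_axioms that])
      (use sub in \<open>auto simp: free_module_simps\<close>)
  have carr: "carrier (RC_int K X d I 1) =
    (\<lambda>c. carrier (short_chains K X d (int_L I) 1) +>\<^bsub>short_chains K X d (int_R I) 1\<^esub> c)
      ` carrier (short_chains K X d (int_R I) 1)"
    by (simp add: RC_int_eq[OF is_cring] I1.carrier_quot)
  have cI: "carrier (short_chains K X d (int_L I) 1) +>\<^bsub>short_chains K X d (int_R I) 1\<^esub> c
      \<in> carrier (RC_int K X d I 1)"
    using c by (auto simp: carr)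
  have "H_int_map K X d J 1 (H_class I c) =
    quot_map (RC_int K X d J 1) (boundaries (RC_int K X d J) (RC_int_diff K X d J) 1) \<iota>
     (boundaries (RC_int K X d I) (RC_int_diff K X d I) 1 +>\<^bsub>RC_int K X d I 1\<^esub>
      (carrier (short_chains K X d (int_L I) 1) +>\<^bsub>short_chains K X d (int_R I) 1\<^esub> c))"
    unfolding H_int_map_def cycles_1[OF J] H_class_def upper \<iota>_def by simp
  also have "\<dots> = boundaries (RC_int K X d J) (RC_int_diff K X d J) 1 +>\<^bsub>RC_int K X d J 1\<^esub>
      \<iota> (carrier (short_chains K X d (int_L I) 1) +>\<^bsub>short_chains K X d (int_R I) 1\<^esub> c)"
  proof (rule IB.quot_map_coset[OF JB.module_quotient_axioms cI])
    fix A assume A: "A \<in> carrier (RC_int K X d I 1)"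
    then obtain u where u: "u \<in> carrier (short_chains K X d (int_R I) 1)"
      "A = carrier (short_chains K X d (int_L I) 1) +>\<^bsub>short_chains K X d (int_R I) 1\<^esub> u"
      unfolding carr by blast
    show "\<iota> A \<in> carrier (RC_int K X d J 1)"
      using u sub(1)[of 1] by (auto simp: \<iota> RC_int_eq[OF is_cring] J1.carrier_quot)
    fix B assume B: "B \<in> carrier (RC_int K X d I 1)"
    then obtain v where v: "v \<in> carrier (short_chains K X d (int_R I) 1)"
      "B = carrier (short_chains K X d (int_L I) 1) +>\<^bsub>short_chains K X d (int_R I) 1\<^esub> v"
      unfolding carr by blast
    have uv: "u \<oplus>\<^bsub>short_chains K X d (int_R I) 1\<^esub> v \<in> carrier (short_chains K X d (int_R I) 1)"
      "u \<oplus>\<^bsub>short_chains K X d (int_R I) 1\<^esub> v = u \<oplus>\<^bsub>short_chains K X d (int_R J) 1\<^esub> v"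
      using I1.M.a_closed[OF u(1) v(1)] by (simp_all add: free_module_simps[of K])
    show "\<iota> (A \<oplus>\<^bsub>RC_int K X d I 1\<^esub> B) = \<iota> A \<oplus>\<^bsub>RC_int K X d J 1\<^esub> \<iota> B"
      using u v sub(1)[of 1] uv
      by (simp add: RC_int_eq[OF is_cring] I1.add_coset J1.add_coset \<iota> subsetD)
  next
    fix A assume "A \<in> boundaries (RC_int K X d I) (RC_int_diff K X d I) 1"
    then obtain e where e: "e \<in> carrier (short_chains K X d (int_R I) 2)" "A =
      carrier (short_chains K X d (int_L I) 1) +>\<^bsub>short_chains K X d (int_R I) 1\<^esub> RC_diff K X d 2 e"
      unfolding boundaries_1[OF I] by blast
    then show "\<iota> A \<in> boundaries (RC_int K X d J) (RC_int_diff K X d J) 1"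
      unfolding boundaries_1[OF J(1)] using \<iota> module_map.closed[OF RC_diff_map_2] sub(1)[of 2] by blast
  qed
  also have "\<dots> = H_class J c"
    unfolding \<iota>[OF c] H_class_def upper ..
  finally show ?thesis .
qed

end

section \<open>Classes of adjacent pairs\<close>

lemma int_R_L_intervals:
  "int_R {l} = {..l}" "int_L {l} = {..<l}"
  "int_minus {l} r = {l - r..l}" "int_plus {l} r = {l..l + r}"
  "a \<le> b \<Longrightarrow> int_R {a..b} = {..b}" "a \<le> b \<Longrightarrow> int_L {a..b} = {..<a}"
proof -
  show R: "int_R {l} = {..l}" and L: "int_L {l} = {..<l}" by (auto simp: int_R_def int_L_def)
  have "(\<lambda>s. s - r) ` {..<l} = {..<l - r}"
    by (auto simp: image_iff intro: exI[of _ "_ + r"]) (metis add_diff_cancel_right' less_diff_eq lessThan_iff)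
  then show "int_minus {l} r = {l - r..l}" by (auto simp: int_minus_def R L)
  have "(\<lambda>s. s + r) ` {..l} = {..l + r}"
    by (auto simp: image_iff) (metis add_diff_cancel_right' diff_add_cancel diff_le_eq atMost_iff)
  then show "int_plus {l} r = {l..l + r}" by (auto simp: int_plus_def R L)
  show "a \<le> b \<Longrightarrow> int_R {a..b} = {..b}" by (auto simp: int_R_def)
  show "a \<le> b \<Longrightarrow> int_L {a..b} = {..<a}" by (force simp: int_L_def)
qed

locale adjacency = quasimetric_chains K X d
  for K :: "('k, 'm) ring_scheme" and X :: "'a set" and d :: "'a \<Rightarrow> 'a \<Rightarrow> ereal" +
  fixes l r :: real
  assumes r_nonneg: "0 \<le> r" and r_less_l: "r < l"
begin

abbreviation sim where "sim \<equiv> pair_equiv X d l r"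
abbreviation pairs where "pairs \<equiv> close_pairs X d (l + r)"
abbreviation adj_pairs where "adj_pairs \<equiv> Adj X d l \<inter> Adj_thick X d l r"

lemma equiv_sim: "equiv pairs sim"
proof (rule equivI)
  have "equiv pairs (pairs \<times> pairs)" "pair_moves X d l r \<subseteq> pairs \<times> pairs"
    by (auto simp: equiv_def refl_on_def sym_def trans_def pair_moves_def)
  then show "sim \<subseteq> pairs \<times> pairs" unfolding pair_equiv_def by blast
  let ?S = "{Q. equiv pairs Q \<and> pair_moves X d l r \<subseteq> Q}"
  show "refl_on pairs sim"
    by (auto simp: pair_equiv_def equiv_def refl_on_def)
  show "sym sim"
    unfolding pair_equiv_def using sym_INTER[of ?S "\<lambda>Q. Q"] by (simp add: equiv_def)
  show "trans sim"
    unfolding pair_equiv_def using trans_INTER[of ?S "\<lambda>Q. Q"] by (simp add: equiv_def)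
qed

lemma moves_in_sim: "pair_moves X d l r \<subseteq> sim"
  unfolding pair_equiv_def by blast

lemma sim_least: "\<lbrakk>equiv pairs Q; pair_moves X d l r \<subseteq> Q\<rbrakk> \<Longrightarrow> sim \<subseteq> Q"
  unfolding pair_equiv_def by blast

lemma pair_in_atMost:
  "[x, y] \<in> short_tuples X d {..t} 1 \<longleftrightarrow> x \<in> X \<and> y \<in> X \<and> x \<noteq> y \<and> d x y \<le> ereal t"
  unfolding pair_short_iff by (auto intro: order_trans)

lemma pair_in_lessThan:
  "[x, y] \<in> short_tuples X d {..<t} 1 \<longleftrightarrow> x \<in> X \<and> y \<in> X \<and> x \<noteq> y \<and> d x y < ereal t"
proof -
  have "(\<exists>s\<in>{..<t}. d x y \<le> ereal s) \<longleftrightarrow> d x y < ereal t" if "x \<in> X" "y \<in> X"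
    using nonneg[OF that] by (cases "d x y") (auto intro: le_less_trans)
  then show ?thesis unfolding pair_short_iff by blast
qed

lemma triple_in_atMost:
  "[x, a, y] \<in> short_tuples X d {..t} 2 \<longleftrightarrow> x \<in> X \<and> a \<in> X \<and> y \<in> X \<and> x \<noteq> a \<and> a \<noteq> y
    \<and> d x a + d a y \<le> ereal t"
  unfolding triple_short_iff by (auto intro: order_trans)

text \<open>The middle point of a short pair may be taken to be its first point.\<close>

lemma short_imp_trivial:
  assumes "x \<in> X" "y \<in> X" "d x y < ereal l" shows "(x, y) \<in> trivial_pairs X d l r"
proof -
  have "d x x = 0" using zero_iff assms by blast
  moreover have "d x y \<le> ereal (l + r)"
    using assms(3) r_nonneg by (cases "d x y") auto
  moreover have "0 < ereal l" using r_nonneg r_less_l by simp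
  ultimately show ?thesis
    using assms by (auto simp: trivial_pairs_def close_pairs_def intro!: bexI[of _ x])
qed

text \<open>A point strictly between \<open>x\<close> and \<open>y\<close> splits the distance \<open>l\<close> into two positive parts, both then
  less than \<open>l\<close>, which makes the pair trivial.\<close>

lemma thick_length_l_is_adjacent:
  assumes "(x, y) \<in> Adj_thick X d l r" and "d x y = ereal l"
  shows "(x, y) \<in> Adj X d l"
proof -
  have pairs: "(x, y) \<in> pairs" and X: "x \<in> X" "y \<in> X"
    using assms by (auto simp: Adj_thick_def close_pairs_def)
  have False if a: "a \<in> X" "a \<noteq> x" "a \<noteq> y" "d x a + d a y = ereal l" for a
  proof -
    have "0 \<le> d x a" "0 \<le> d a y" "d x a \<noteq> 0" "d a y \<noteq> 0"
      using nonneg zero_iff X a by auto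
    then have "d x a < ereal l" "d a y < ereal l"
      using a(4) by (cases "d x a"; cases "d a y"; auto)+
    then have "(x, y) \<in> trivial_pairs X d l r"
      using pairs a r_nonneg by (auto simp: trivial_pairs_def intro!: bexI[of _ a])
    then show False
      using assms(1) pairs equiv_sim by (auto simp: Adj_thick_def equiv_def refl_on_def)
  qed
  then show ?thesis using assms(2) X by (auto simp: Adj_def)
qed

text \<open>Only the part of the equivalence class inside \<open>adj_pairs\<close> is kept, so that the value is an element
  of the quotient of \<open>adj_pairs\<close>, or empty.\<close>

definition cls :: "'a \<times> 'a \<Rightarrow> ('a \<times> 'a) set" where
  "cls p = sim `` {p} \<inter> adj_pairs"

lemma adj_pairs_sub: "adj_pairs \<subseteq> pairs" by (auto simp: Adj_thick_def)

lemma cls_self: "p \<in> adj_pairs \<Longrightarrow> p \<in> cls p"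
  using equiv_sim adj_pairs_sub unfolding cls_def equiv_def refl_on_def by blast

lemma cls_cong: "(p, q) \<in> sim \<Longrightarrow> cls p = cls q"
  unfolding cls_def using equiv_class_eq[OF equiv_sim] by blast

lemma cls_trivial: "p \<in> sim `` trivial_pairs X d l r \<Longrightarrow> cls p = {}"
  using equiv_sim unfolding cls_def Adj_thick_def equiv_def trans_def by blast

lemma cls_eq_quotient: "p \<in> adj_pairs \<Longrightarrow> cls p = Restr sim adj_pairs `` {p}"
  by (auto simp: cls_def)

lemma cls_in_quotient: "cls p \<noteq> {} \<Longrightarrow> cls p \<in> adj_pairs // Restr sim adj_pairs"
proof -
  assume "cls p \<noteq> {}"
  then obtain q where "(p, q) \<in> sim" "q \<in> adj_pairs" by (auto simp: cls_def)
  then show ?thesis by (metis cls_cong cls_eq_quotient quotientI)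
qed

lemma quotient_cls:
  assumes "C \<in> adj_pairs // Restr sim adj_pairs" and "p \<in> C" shows "p \<in> adj_pairs" "cls p = C"
proof -
  obtain q where q: "q \<in> adj_pairs" "C = cls q"
    using assms(1) by (auto simp: cls_eq_quotient elim!: quotientE)
  then show "p \<in> adj_pairs" "cls p = C"
    using assms(2) cls_cong[of q p] by (auto simp: cls_def)
qed

lemma quotient_nonempty: "C \<in> adj_pairs // Restr sim adj_pairs \<Longrightarrow> C \<noteq> {}"
  using cls_self by (auto simp: cls_eq_quotient elim!: quotientE)

abbreviation class_module where "class_module \<equiv> free_module K (adj_pairs // Restr sim adj_pairs)"

text \<open>The value of a pair in the free module on classes. It vanishes on classes of trivial pairs, and
  also on classes without a pair at distance \<open>l\<close>. The latter are harmless, because chains of length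
  at most \<open>l\<close> do not see them.\<close>

definition cls_vec :: "'a \<times> 'a \<Rightarrow> ('a \<times> 'a) set \<Rightarrow> 'k" where
  "cls_vec p = (if cls p = {} then \<zero>\<^bsub>class_module\<^esub> else free_basis K (cls p))"

lemma cls_vec_closed: "cls_vec p \<in> carrier class_module"
proof -
  interpret G: module K class_module by (rule module_free_module)
  show ?thesis
    using free_basis_closed[OF cls_in_quotient[of p]] by (cases "cls p = {}") (simp_all add: cls_vec_def)
qed

lemma cls_vec_trivial: "\<lbrakk>x \<in> X; y \<in> X; d x y < ereal l\<rbrakk> \<Longrightarrow> cls_vec (x, y) = \<zero>\<^bsub>class_module\<^esub>"
proof -
  assume "x \<in> X" "y \<in> X" "d x y < ereal l"
  then have "(x, y) \<in> trivial_pairs X d l r" by (rule short_imp_trivial)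
  moreover have "((x, y), (x, y)) \<in> sim"
    using calculation equiv_sim by (auto simp: trivial_pairs_def equiv_def refl_on_def)
  ultimately have "cls (x, y) = {}" by (intro cls_trivial) blast
  then show ?thesis by (simp add: cls_vec_def)
qed

text \<open>At most one of the two parts has length at least \<open>l\<close>. Without such a part the pair is trivial.
  With one, the other part has length at most \<open>r\<close>, so \<open>(x, y)\<close> moves to the long part while the short
  part contributes zero.\<close>

lemma cls_vec_triangle:
  assumes X: "x \<in> X" "a \<in> X" "y \<in> X" and sum: "d x a + d a y \<le> ereal (l + r)"
  shows "cls_vec (x, y) = cls_vec (a, y) \<oplus>\<^bsub>class_module\<^esub> cls_vec (x, a)"
proof -
  interpret G: module K class_module by (rule module_free_module)
  have nn: "0 \<le> d x a" "0 \<le> d a y" using nonneg X by auto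
  then have le: "d x a \<le> ereal (l + r)" "d a y \<le> ereal (l + r)"
    using sum by (cases "d x a"; cases "d a y"; auto)+
  have xy: "d x y \<le> ereal (l + r)" using triangle[OF X] sum by (rule order_trans)
  consider "d x a < ereal l" "d a y < ereal l" | "ereal l \<le> d x a" | "ereal l \<le> d a y"
    by force
  then show ?thesis
  proof cases
    case 1
    then have triv: "(x, y) \<in> trivial_pairs X d l r"
      using X xy sum by (auto simp: trivial_pairs_def close_pairs_def)
    then have "((x, y), (x, y)) \<in> sim"
      using equiv_sim by (auto simp: trivial_pairs_def equiv_def refl_on_def)
    with triv have "cls (x, y) = {}" by (intro cls_trivial) blast
    then have "cls_vec (x, y) = \<zero>\<^bsub>class_module\<^esub>" by (simp add: cls_vec_def)
    then show ?thesis using 1 X by (simp add: cls_vec_trivial)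
  next
    case 2
    then have r: "d a y \<le> ereal r"
      using sum nn by (cases "d x a"; cases "d a y") auto
    then have "d a y < ereal l" using r_less_l by (cases "d a y") auto
    moreover have "((x, y), (x, a)) \<in> sim"
      using X r sum le xy by (intro subsetD[OF moves_in_sim]) (auto simp: pair_moves_def close_pairs_def)
    then have "cls_vec (x, y) = cls_vec (x, a)" by (simp add: cls_vec_def cls_cong)
    ultimately show ?thesis using X cls_vec_closed[of "(x, a)"] by (simp add: cls_vec_trivial)
  next
    case 3
    then have r: "d x a \<le> ereal r"
      using sum nn by (cases "d x a"; cases "d a y") auto
    then have "d x a < ereal l" using r_less_l by (cases "d x a") auto
    moreover have "((x, y), (a, y)) \<in> sim"
      using X r sum le xy by (intro subsetD[OF moves_in_sim]) (auto simp: pair_moves_def close_pairs_def)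
    then have "cls_vec (x, y) = cls_vec (a, y)" by (simp add: cls_vec_def cls_cong)
    ultimately show ?thesis using X cls_vec_closed[of "(a, y)"] by (simp add: cls_vec_trivial)
  qed
qed

definition class_map :: "('a list \<Rightarrow> 'k) \<Rightarrow> ('a \<times> 'a) set \<Rightarrow> 'k" where
  "class_map = free_lift K class_module (\<lambda>xs. cls_vec (hd xs, last xs))"

lemma class_map_map: "module_map K (short_chains K X d T 1) class_module class_map"
  unfolding class_map_def by (intro free_lift_map module_free_module cls_vec_closed)

lemma class_map_pair:
  assumes "x \<in> X" "y \<in> X" "d x y < \<infinity>"
  shows "class_map (tuple_elt K [x, y]) = cls_vec (x, y)"
proof (cases "x = y")
  case True
  have "d x x = 0" using zero_iff assms by blast
  then have "cls_vec (x, y) = \<zero>\<^bsub>class_module\<^esub>"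
    using assms True r_nonneg r_less_l by (intro cls_vec_trivial) auto
  moreover have "tuple_elt K [x, y] = \<zero>\<^bsub>short_chains K X d UNIV 1\<^esub>"
    using True by (simp add: tuple_elt_def free_module_simps)
  ultimately show ?thesis
    using module_map.zero[OF class_map_map[of UNIV]] by simp
next
  case False
  have "d x y \<noteq> - \<infinity>" using nonneg[OF assms(1,2)] by auto
  then have "[x, y] \<in> short_tuples X d UNIV 1"
    using assms False unfolding pair_short_iff by (cases "d x y") auto
  then show ?thesis
    using False free_lift_basis[OF module_free_module cls_vec_closed, of "[x, y]" "short_tuples X d UNIV 1"]
    by (simp add: class_map_def tuple_elt_eq)
qed

lemma class_map_boundary:
  assumes "e \<in> carrier (short_chains K X d {..l + r} 2)"
  shows "class_map (RC_diff K X d 2 e) = \<zero>\<^bsub>class_module\<^esub>"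
proof -
  interpret G: module K class_module by (rule module_free_module)
  interpret c: module_map K "short_chains K X d {..l + r} 1" class_module class_map
    by (rule class_map_map)
  have "class_map (RC_diff K X d 2 (free_basis K xs)) \<in> {\<zero>\<^bsub>class_module\<^esub>}"
    if "xs \<in> short_tuples X d {..l + r} 2" for xs
  proof -
    obtain x a y where xs: "xs = [x, a, y]" "[x, a, y] \<in> short_tuples X d {..l + r} 2"
      using triple_shape[OF \<open>xs \<in> _\<close>] .
    have X: "x \<in> X" "a \<in> X" "y \<in> X" "d x a + d a y \<le> ereal (l + r)"
      using xs(2) by (auto simp: triple_in_atMost)
    have f: "tuple_elt K [a, y] \<in> carrier (short_chains K X d {..l + r} 1)"
      "tuple_elt K [x, a] \<in> carrier (short_chains K X d {..l + r} 1)"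
      "tuple_elt K [x, y] \<in> carrier (short_chains K X d {..l + r} 1)"
      using triple_faces_short[OF xs(2)] by (auto intro!: tuple_elt_closed)
    have "0 \<le> d x a" "0 \<le> d a y" using nonneg X by auto
    then have fin: "d x a < \<infinity>" "d a y < \<infinity>" using X(4) by (cases "d x a"; cases "d a y"; auto)+
    have "d x y \<le> ereal (l + r)" using triangle[OF X(1-3)] X(4) by (rule order_trans)
    then have "d x y < \<infinity>" by (auto simp: less_top[symmetric])
    then have "class_map (RC_diff K X d 2 (free_basis K xs)) =
      (cls_vec (a, y) \<oplus>\<^bsub>class_module\<^esub> cls_vec (x, a)) \<ominus>\<^bsub>class_module\<^esub> cls_vec (x, y)"
      using f fin X by (simp add: xs(1) RC_diff_basis_triple[OF xs(2)] c.diff c.add class_map_pair)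
    then show ?thesis
      using cls_vec_triangle[OF X] cls_vec_closed[of "(x, y)"] G.minus_eq_zero_iff by simp
  qed
  then have "class_map (RC_diff K X d 2 e) \<in> {\<zero>\<^bsub>class_module\<^esub>}"
    using module_map_into_submodule[OF module_map_comp[OF RC_diff_map_2 class_map_map] G.submodule_zero _ assms]
    by blast
  then show ?thesis by simp
qed

lemma class_map_below:
  assumes "c \<in> carrier (short_chains K X d {..<l} 1)"
  shows "class_map c = \<zero>\<^bsub>class_module\<^esub>"
proof -
  interpret G: module K class_module by (rule module_free_module)
  have "class_map (free_basis K xs) \<in> {\<zero>\<^bsub>class_module\<^esub>}" if "xs \<in> short_tuples X d {..<l} 1" for xs
  proof -
    obtain x y where xs: "xs = [x, y]" "[x, y] \<in> short_tuples X d {..<l} 1"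
      using pair_shape[OF \<open>xs \<in> _\<close>] .
    then have X: "x \<in> X" "y \<in> X" "x \<noteq> y" "d x y < ereal l" by (auto simp: pair_in_lessThan)
    then have "d x y < \<infinity>" by (auto intro: less_trans)
    then show ?thesis
      using X class_map_pair[of x y] by (simp add: xs(1) tuple_elt_eq cls_vec_trivial)
  qed
  then have "class_map c \<in> {\<zero>\<^bsub>class_module\<^esub>}"
    using module_map_into_submodule[OF class_map_map G.submodule_zero _ assms] by blast
  then show ?thesis by simp
qed

text \<open>A section of \<open>class_map\<close>, given by a choice of representatives.\<close>

definition rep_map :: "(('a \<times> 'a) set \<Rightarrow> 'k) \<Rightarrow> 'a list \<Rightarrow> 'k" where
  "rep_map = free_lift K (short_chains K X d {..l} 1)
    (\<lambda>C. case SOME p. p \<in> C of (x, y) \<Rightarrow> tuple_elt K [x, y])"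

lemma
  shows rep_map_map: "module_map K class_module (short_chains K X d {..l} 1) rep_map"
    and rep_map_basis: "C \<in> adj_pairs // Restr sim adj_pairs \<Longrightarrow>
      \<exists>x y. (x, y) \<in> C \<and> rep_map (free_basis K C) = tuple_elt K [x, y]"
proof -
  let ?t = "\<lambda>C. case SOME p. p \<in> C of (x, y) \<Rightarrow> tuple_elt K [x, y]"
  have rep: "\<exists>x y. (x, y) \<in> C \<and> ?t C = tuple_elt K [x, y]"
    if "C \<in> adj_pairs // Restr sim adj_pairs" for C
    using quotient_nonempty[OF that] some_in_eq[of C] by (cases "SOME p. p \<in> C") auto
  have closed: "?t C \<in> carrier (short_chains K X d {..l} 1)"
    if C: "C \<in> adj_pairs // Restr sim adj_pairs" for C
  proof -
    obtain x y where xy: "(x, y) \<in> C" "?t C = tuple_elt K [x, y]" using rep[OF C] by blast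
    have "(x, y) \<in> adj_pairs" using quotient_cls(1)[OF C xy(1)] .
    then have "distinct_adj [x, y] \<Longrightarrow> [x, y] \<in> short_tuples X d {..l} 1"
      by (auto simp: pair_in_atMost Adj_def)
    then show ?thesis unfolding xy(2) by (rule tuple_elt_closed)
  qed
  show "module_map K class_module (short_chains K X d {..l} 1) rep_map"
    unfolding rep_map_def by (intro free_lift_map module_free_module closed)
  show "\<exists>x y. (x, y) \<in> C \<and> rep_map (free_basis K C) = tuple_elt K [x, y]"
    if C: "C \<in> adj_pairs // Restr sim adj_pairs"
  proof -
    have "rep_map (free_basis K C) = ?t C"
      unfolding rep_map_def by (rule free_lift_basis[OF module_free_module _ C]) (rule closed)
    then show ?thesis using rep[OF C] by simp
  qed
qed

lemma class_map_rep_map: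
  assumes "g \<in> carrier class_module" shows "class_map (rep_map g) = g"
proof (rule module_map_eqI[OF module_map_comp[OF rep_map_map class_map_map] _ _ assms])
  show "module_map K class_module class_module (\<lambda>g. g)"
    by (rule free_module_inclusion_map) simp
  fix C assume C: "C \<in> adj_pairs // Restr sim adj_pairs"
  obtain x y where xy: "(x, y) \<in> C" "rep_map (free_basis K C) = tuple_elt K [x, y]"
    using rep_map_basis[OF C] by blast
  have "(x, y) \<in> adj_pairs" "cls (x, y) = C" using quotient_cls[OF C xy(1)] .
  then show "class_map (rep_map (free_basis K C)) = free_basis K C"
    using xy(1) by (auto simp: xy(2) class_map_pair Adj_def cls_vec_def)
qed

lemma class_map_surj: "class_map ` carrier (short_chains K X d {..l} 1) = carrier class_module"
  using class_map_rep_map module_map.closed[OF rep_map_map] module_map.closed[OF class_map_map]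
  by (auto simp: image_iff) metis

section \<open>Homology classes of pairs\<close>

text \<open>In the homology of the interval \<open>[l, l + r]\<close> the surviving cycles of \<open>{l}\<close> are tested for being
  boundaries.\<close>

abbreviation (input) wide_class where "wide_class \<equiv> H_class {l..l + r}"

lemma plus_interval: "int_R {l..l + r} = {..l + r}" "int_L {l..l + r} = {..<l}"
    "int_L {l..l + r} \<subseteq> int_R {l..l + r}" "0 \<in> int_L {l..l + r}"
  using r_nonneg r_less_l by (auto simp: int_R_L_intervals)

lemma wide_class_map: "module_map K (short_chains K X d {..l + r} 1) (H_int K X d {l..l + r} 1) wide_class"
  using H_class_map[OF plus_interval(3,4)] by (simp add: plus_interval)

lemma wide_class_zero_iff:
  "c \<in> carrier (short_chains K X d {..l + r} 1) \<Longrightarrow> wide_class c = \<zero>\<^bsub>H_int K X d {l..l + r} 1\<^esub> \<longleftrightarrow>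
    (\<exists>e\<in>carrier (short_chains K X d {..l + r} 2).
      c \<ominus>\<^bsub>short_chains K X d {..l + r} 1\<^esub> RC_diff K X d 2 e \<in> carrier (short_chains K X d {..<l} 1))"
  using H_class_zero_iff[OF plus_interval(3,4)] by (simp add: plus_interval)

lemma pair_closed:
  "\<lbrakk>x \<in> X; y \<in> X; d x y \<le> ereal t\<rbrakk> \<Longrightarrow> tuple_elt K [x, y] \<in> carrier (short_chains K X d {..t} 1)"
  by (rule tuple_elt_closed) (simp add: pair_in_atMost)

lemma wide_class_short:
  assumes "x \<in> X" "y \<in> X" "d x y < ereal l"
  shows "wide_class (tuple_elt K [x, y]) = \<zero>\<^bsub>H_int K X d {l..l + r} 1\<^esub>"
proof -
  interpret D: module_map K "short_chains K X d {..l + r} 2" "short_chains K X d {..l + r} 1" "RC_diff K X d 2"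
    by (rule RC_diff_map_2)
  have "d x y \<le> ereal (l + r)" using assms(3) r_nonneg by (cases "d x y") auto
  then have t: "tuple_elt K [x, y] \<in> carrier (short_chains K X d {..l + r} 1)"
    using assms by (intro pair_closed)
  have "tuple_elt K [x, y] \<in> carrier (short_chains K X d {..<l} 1)"
    using assms by (intro tuple_elt_closed) (simp add: pair_in_lessThan)
  moreover have "tuple_elt K [x, y] \<ominus>\<^bsub>short_chains K X d {..l + r} 1\<^esub>
      RC_diff K X d 2 \<zero>\<^bsub>short_chains K X d {..l + r} 2\<^esub> = tuple_elt K [x, y]"
    using t by (simp add: D.zero D.N.M.minus_eq)
  ultimately show ?thesis
    unfolding wide_class_zero_iff[OF t] by (intro bexI[of _ "\<zero>\<^bsub>short_chains K X d {..l + r} 2\<^esub>"]) auto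
qed

text \<open>For a nondegenerate triple this is the statement that its boundary is zero in homology; in the
  degenerate cases one part is a pair \<open>(z, z)\<close> and contributes zero.\<close>

lemma wide_class_triangle:
  assumes X: "x \<in> X" "a \<in> X" "y \<in> X" and sum: "d x a + d a y \<le> ereal (l + r)"
  shows "wide_class (tuple_elt K [x, y]) = wide_class (tuple_elt K [a, y])
    \<oplus>\<^bsub>H_int K X d {l..l + r} 1\<^esub> wide_class (tuple_elt K [x, a])"
proof -
  interpret h: module_map K "short_chains K X d {..l + r} 1" "H_int K X d {l..l + r} 1" wide_class
    by (rule wide_class_map)
  interpret D: module_map K "short_chains K X d {..l + r} 2" "short_chains K X d {..l + r} 1" "RC_diff K X d 2"
    by (rule RC_diff_map_2)
  have nn: "0 \<le> d x a" "0 \<le> d a y" using nonneg X by auto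
  then have le: "d x a \<le> ereal (l + r)" "d a y \<le> ereal (l + r)"
    using sum by (cases "d x a"; cases "d a y"; auto)+
  have xy: "d x y \<le> ereal (l + r)" using triangle[OF X] sum by (rule order_trans)
  note t = pair_closed[OF X(1,3) xy] pair_closed[OF X(1,2) le(1)] pair_closed[OF X(2,3) le(2)]
  have self: "wide_class (tuple_elt K [z, z]) = \<zero>\<^bsub>H_int K X d {l..l + r} 1\<^esub>" if "z \<in> X" for z
    using that zero_iff[of z z] r_nonneg r_less_l by (intro wide_class_short) auto
  consider "x = a" | "a = y" | "[x, a, y] \<in> short_tuples X d {..l + r} 2"
    using X sum by (auto simp: triple_in_atMost)
  then show ?thesis
  proof cases
    case 1 then show ?thesis using self X t h.closed by simp
  next
    case 2 then show ?thesis using self X t h.closed by simp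
  next
    case 3
    let ?b = "RC_diff K X d 2 (free_basis K [x, a, y])"
    have b: "free_basis K [x, a, y] \<in> carrier (short_chains K X d {..l + r} 2)"
      using 3 by (rule free_basis_closed)
    have "?b \<ominus>\<^bsub>short_chains K X d {..l + r} 1\<^esub> ?b \<in> carrier (short_chains K X d {..<l} 1)"
      using D.closed[OF b] h.M.minus_eq_zero_iff[of ?b ?b] by (simp add: free_module_carrier_iff free_module_simps)
    then have "wide_class ?b = \<zero>\<^bsub>H_int K X d {l..l + r} 1\<^esub>"
      using wide_class_zero_iff[OF D.closed[OF b]] b by blast
    then have "(wide_class (tuple_elt K [a, y]) \<oplus>\<^bsub>H_int K X d {l..l + r} 1\<^esub> wide_class (tuple_elt K [x, a]))
      \<ominus>\<^bsub>H_int K X d {l..l + r} 1\<^esub> wide_class (tuple_elt K [x, y]) = \<zero>\<^bsub>H_int K X d {l..l + r} 1\<^esub>"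
      using t by (simp add: RC_diff_basis_triple[OF 3] h.diff h.add)
    then show ?thesis
      using t h.closed h.N.minus_eq_zero_iff by simp
  qed
qed

text \<open>Having equal homology classes is an equivalence relation, and by the triangle relation it
  contains the elementary moves, since the part that is cut off has length at most \<open>r < l\<close>. Minimality
  of \<open>sim\<close> gives the rest.\<close>

lemma wide_class_sim:
  assumes "((x, y), (x', y')) \<in> sim"
  shows "wide_class (tuple_elt K [x, y]) = wide_class (tuple_elt K [x', y'])"
proof -
  interpret h: module_map K "short_chains K X d {..l + r} 1" "H_int K X d {l..l + r} 1" wide_class
    by (rule wide_class_map)
  let ?h = "\<lambda>(x, y). wide_class (tuple_elt K [x, y])"
  let ?Q = "{(p, q) \<in> pairs \<times> pairs. ?h p = ?h q}"
  have h: "wide_class (tuple_elt K [x, y]) \<in> carrier (H_int K X d {l..l + r} 1)" if "(x, y) \<in> pairs" for x y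
    using that by (intro h.closed pair_closed) (auto simp: close_pairs_def)
  have short: "wide_class (tuple_elt K [x, y]) = \<zero>\<^bsub>H_int K X d {l..l + r} 1\<^esub>"
    if "x \<in> X" "y \<in> X" "d x y \<le> ereal r" for x y
    using that r_less_l by (intro wide_class_short) (auto intro: le_less_trans)
  have "equiv pairs ?Q"
    by (auto simp: equiv_def refl_on_def sym_def trans_def)
  moreover have "pair_moves X d l r \<subseteq> ?Q"
    unfolding pair_moves_def
  proof (rule Un_least; clarsimp)
    fix x x' y
    assume xy: "(x, y) \<in> pairs" "(x', y) \<in> pairs" "d x x' \<le> ereal r" "d x x' + d x' y \<le> ereal (l + r)"
    then show "wide_class (tuple_elt K [x, y]) = wide_class (tuple_elt K [x', y])"
      using wide_class_triangle[of x x' y] short[of x x'] h[OF xy(2)] by (auto simp: close_pairs_def)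
  next
    fix x y y'
    assume xy: "(x, y) \<in> pairs" "(x, y') \<in> pairs" "d y' y \<le> ereal r" "d x y' + d y' y \<le> ereal (l + r)"
    then show "wide_class (tuple_elt K [x, y]) = wide_class (tuple_elt K [x, y'])"
      using wide_class_triangle[of x y' y] short[of y' y] h[OF xy(2)] by (auto simp: close_pairs_def)
  qed
  ultimately have "sim \<subseteq> ?Q" by (rule sim_least)
  then show ?thesis using assms by auto
qed

lemma wide_class_trivial:
  assumes "(x, y) \<in> sim `` trivial_pairs X d l r"
  shows "wide_class (tuple_elt K [x, y]) = \<zero>\<^bsub>H_int K X d {l..l + r} 1\<^esub>"
proof -
  interpret h: module_map K "short_chains K X d {..l + r} 1" "H_int K X d {l..l + r} 1" wide_class
    by (rule wide_class_map)
  obtain u v where uv: "(u, v) \<in> trivial_pairs X d l r" "((u, v), (x, y)) \<in> sim"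
    using assms by auto
  then obtain a where a: "a \<in> X" "u \<in> X" "v \<in> X" "d u a + d a v \<le> ereal (l + r)"
      "d u a < ereal l" "d a v < ereal l"
    by (auto simp: trivial_pairs_def close_pairs_def)
  then have "wide_class (tuple_elt K [u, v]) = \<zero>\<^bsub>H_int K X d {l..l + r} 1\<^esub>"
    by (simp add: wide_class_triangle[of u a v] wide_class_short)
  then show ?thesis using wide_class_sim[OF uv(2)] by simp
qed

lemma l_chains_sub: "short_tuples X d {..l} 1 \<subseteq> short_tuples X d {..l + r} 1"
  using r_nonneg by (intro short_tuples_mono) auto

text \<open>It suffices to look at one pair of length at most \<open>l\<close>. If it is equivalent to a trivial pair, both
  sides vanish. Otherwise its length is \<open>l\<close>, since shorter pairs are trivial, so it is adjacent and
  equivalent to the chosen representative of its class.\<close>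

lemma wide_class_rep_map:
  assumes "c \<in> carrier (short_chains K X d {..l} 1)"
  shows "wide_class (rep_map (class_map c)) = wide_class c"
proof -
  have h: "module_map K (short_chains K X d {..l} 1) (H_int K X d {l..l + r} 1) wide_class"
    using module_map_comp[OF free_module_inclusion_map[OF l_chains_sub] wide_class_map] .
  interpret h: module_map K "short_chains K X d {..l} 1" "H_int K X d {l..l + r} 1" wide_class by (rule h)
  interpret rep: module_map K class_module "short_chains K X d {..l} 1" rep_map by (rule rep_map_map)
  show ?thesis
  proof (rule module_map_eqI[OF module_map_comp[OF module_map_comp[OF class_map_map rep_map_map] h] h _ assms])
    fix xs assume "xs \<in> short_tuples X d {..l} 1"
    then obtain x y where xs: "xs = [x, y]" "[x, y] \<in> short_tuples X d {..l} 1"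
      by (rule pair_shape)
    then have X: "x \<in> X" "y \<in> X" "x \<noteq> y" "d x y \<le> ereal l" by (auto simp: pair_in_atMost)
    then have basis: "free_basis K xs = tuple_elt K [x, y]" by (simp add: xs(1) tuple_elt_eq)
    have "d x y < \<infinity>" using X(4) by (auto intro: le_less_trans)
    then have class_map: "class_map (tuple_elt K [x, y]) = cls_vec (x, y)"
      using X by (intro class_map_pair)
    have pair: "(x, y) \<in> pairs"
      using X r_nonneg by (auto simp: close_pairs_def intro: order_trans)
    show "wide_class (rep_map (class_map (free_basis K xs))) = wide_class (free_basis K xs)"
    proof (cases "(x, y) \<in> Adj_thick X d l r")
      case False
      then have "(x, y) \<in> sim `` trivial_pairs X d l r" using pair by (auto simp: Adj_thick_def)
      then show ?thesis
        unfolding basis class_map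
        by (simp add: wide_class_trivial cls_vec_def cls_trivial rep.zero h.zero)
    next
      case True
      have "(x, y) \<notin> trivial_pairs X d l r"
        using True pair equiv_sim by (auto simp: Adj_thick_def equiv_def refl_on_def)
      then have "d x y = ereal l"
        using short_imp_trivial[of x y] X by (auto simp: less_le)
      then have A: "(x, y) \<in> adj_pairs" using True thick_length_l_is_adjacent by blast
      then have ne: "cls (x, y) \<noteq> {}" using cls_self by blast
      obtain u v where uv: "(u, v) \<in> cls (x, y)"
        "rep_map (free_basis K (cls (x, y))) = tuple_elt K [u, v]"
        using rep_map_basis[OF cls_in_quotient[OF ne]] by blast
      have "((x, y), (u, v)) \<in> sim" using uv(1) by (auto simp: cls_def)
      then show ?thesis
        unfolding basis class_map using ne by (simp add: cls_vec_def uv(2) wide_class_sim)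
    qed
  qed
qed

text \<open>This identifies the two kernels. From left to right the section is used; from right to left a
  chain with zero homology class is a boundary plus a chain of length below \<open>l\<close>, and \<open>class_map\<close> kills
  both.\<close>

lemma class_map_zero_iff:
  assumes c: "c \<in> carrier (short_chains K X d {..l} 1)"
  shows "class_map c = \<zero>\<^bsub>class_module\<^esub> \<longleftrightarrow> wide_class c = \<zero>\<^bsub>H_int K X d {l..l + r} 1\<^esub>"
proof
  assume "class_map c = \<zero>\<^bsub>class_module\<^esub>"
  then show "wide_class c = \<zero>\<^bsub>H_int K X d {l..l + r} 1\<^esub>"
    using wide_class_rep_map[OF c] module_map.zero[OF rep_map_map] module_map.zero[OF wide_class_map]
    by (simp add: free_module_simps)
next
  interpret D: module_map K "short_chains K X d {..l + r} 2" "short_chains K X d {..l + r} 1" "RC_diff K X d 2"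
    by (rule RC_diff_map_2)
  interpret c: module_map K "short_chains K X d {..l + r} 1" class_module class_map
    by (rule class_map_map)
  have c': "c \<in> carrier (short_chains K X d {..l + r} 1)"
    using free_module_carrier_mono[OF l_chains_sub] c by blast
  assume "wide_class c = \<zero>\<^bsub>H_int K X d {l..l + r} 1\<^esub>"
  then obtain e where e: "e \<in> carrier (short_chains K X d {..l + r} 2)"
    "c \<ominus>\<^bsub>short_chains K X d {..l + r} 1\<^esub> RC_diff K X d 2 e \<in> carrier (short_chains K X d {..<l} 1)"
    unfolding wide_class_zero_iff[OF c'] by blast
  have "class_map c \<ominus>\<^bsub>class_module\<^esub> \<zero>\<^bsub>class_module\<^esub> = \<zero>\<^bsub>class_module\<^esub>"
    using class_map_below[OF e(2)] class_map_boundary[OF e(1)] D.closed[OF e(1)] c' by (simp add: c.diff)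
  then show "class_map c = \<zero>\<^bsub>class_module\<^esub>"
    using c.N.minus_eq_zero_iff[OF c.closed[OF c']] by simp
qed

lemma spectral_homology_iso: "isomorphic_modules K (SH K X d r 1 {l}) class_module"
proof -
  note I = int_R_L_intervals
  let ?C = "short_chains K X d {..l} 1"
  let ?H = "H_int K X d {l} 1"
  have ml: "l - r \<le> l" using r_nonneg by simp
  have one: "int_L {l} \<subseteq> int_R {l}" "0 \<in> int_L {l}"
    using r_nonneg r_less_l by (auto simp: I)
  have minus: "int_L {l - r..l} \<subseteq> int_R {l - r..l}" "0 \<in> int_L {l - r..l}" "int_R {l - r..l} = {..l}"
    "int_L {l - r..l} \<subseteq> int_L {l}"
    using r_nonneg r_less_l by (auto simp: I)
  interpret p: module_map K ?C ?H "H_class {l}"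
    using H_class_map[OF one] by (simp add: I)
  have p_surj: "H_class {l} ` carrier ?C = carrier ?H"
    using H_class_surj[OF one] by (simp add: I)
  interpret h: module_map K ?C "H_int K X d {l..l + r} 1" wide_class
    using module_map_comp[OF free_module_inclusion_map[OF l_chains_sub] wide_class_map] .
  have to_plus: "H_int_map K X d {l..l + r} 1 (H_class {l} c) = wide_class c" if "c \<in> carrier ?C" for c
    using that r_nonneg by (intro H_int_map_class one(1) plus_interval(3,4)) (auto simp: I)
  \<comment> \<open>Every 1-chain of length at most \<open>l\<close> is a cycle over \<open>[l - r, l]\<close> as well.\<close>
  have SZ: "SZ K X d r 1 {l} = carrier ?H"
  proof -
    have "H_int_map K X d {l} 1 (H_class {l - r..l} c) = H_class {l} c" if "c \<in> carrier ?C" for c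
      using that minus by (intro H_int_map_class minus one) (auto simp: I)
    then have "H_int_map K X d {l} 1 ` H_class {l - r..l} ` carrier ?C = H_class {l} ` carrier ?C"
      unfolding image_image by (rule image_cong[OF refl])
    then show ?thesis
      using H_class_surj[OF minus(1,2)] p_surj by (simp add: SZ_def I minus(3))
  qed
  have SB: "SB K X d r 1 {l} = H_class {l} ` {c \<in> carrier ?C. wide_class c \<in> {\<zero>\<^bsub>H_int K X d {l..l + r} 1\<^esub>}}"
    unfolding SB_def I(4) a_kernel_def' p_surj[symmetric] using to_plus by auto
  have "submodule (SB K X d r 1 {l}) K ?H"
    unfolding SB by (intro p.submodule_image h.submodule_vimage h.N.submodule_zero)
  then interpret Q: module_quotient K ?H "SB K X d r 1 {l}"
    using p.N.module_axioms by (intro module_quotient.intro module_quotient_axioms.intro)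
  have SH: "SH K X d r 1 {l} = quot_module ?H (SB K X d r 1 {l})"
    by (simp add: SH_def SZ)
  show ?thesis
    unfolding SH
  proof (rule isomorphic_modules_of_same_kernel)
    show "module_map K ?C (quot_module ?H (SB K X d r 1 {l})) (\<lambda>c. SB K X d r 1 {l} +>\<^bsub>?H\<^esub> H_class {l} c)"
      by (rule module_map_comp[OF p.module_map_axioms Q.quot_proj])
    show "module_map K ?C class_module class_map" by (rule class_map_map)
    show "(\<lambda>c. SB K X d r 1 {l} +>\<^bsub>?H\<^esub> H_class {l} c) ` carrier ?C = carrier (quot_module ?H (SB K X d r 1 {l}))"
      by (simp add: Q.carrier_quot p_surj[symmetric] image_image)
    show "class_map ` carrier ?C = carrier class_module" by (rule class_map_surj)
    fix c assume c: "c \<in> carrier ?C"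
    have "SB K X d r 1 {l} +>\<^bsub>?H\<^esub> H_class {l} c = \<zero>\<^bsub>quot_module ?H (SB K X d r 1 {l})\<^esub>
        \<longleftrightarrow> H_class {l} c \<in> SB K X d r 1 {l}"
      using Q.coset_eq_sub_iff p.closed[OF c] by (simp add: Q.zero_quot)
    also have "\<dots> \<longleftrightarrow> wide_class c = \<zero>\<^bsub>H_int K X d {l..l + r} 1\<^esub>"
      unfolding SB_def I(4) a_kernel_def' mem_Collect_eq to_plus[OF c] using p.closed[OF c] by blast
    also have "\<dots> \<longleftrightarrow> class_map c = \<zero>\<^bsub>class_module\<^esub>"
      using class_map_zero_iff[OF c] by simp
    finally show "SB K X d r 1 {l} +>\<^bsub>?H\<^esub> H_class {l} c = \<zero>\<^bsub>quot_module ?H (SB K X d r 1 {l})\<^esub>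
        \<longleftrightarrow> class_map c = \<zero>\<^bsub>class_module\<^esub>" .
  qed
qed

end

theorem theorem4p14:
  fixes K :: "('k, 'm) ring_scheme"
    and X :: "'a set" and d :: "'a \<Rightarrow> 'a \<Rightarrow> ereal"
    and l r :: real
  assumes "cring K"
    and "quasimetric_space X d"
    and "0 \<le> r" and "r < l"
  shows "isomorphic_modules K (SH K X d r 1 {l})
    (free_module K ((Adj X d l \<inter> Adj_thick X d l r) //
      Restr (pair_equiv X d l r) (Adj X d l \<inter> Adj_thick X d l r)))"
proof -
  interpret adjacency K X d l r
    using assms by (intro adjacency.intro quasimetric_chains.intro adjacency_axioms.intro)
  show ?thesis by (rule spectral_homology_iso)
qed

end
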